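(* Let $d\ge1$ and $\alpha\in(0,2)$. There exists a constant $c=c(d,\alpha)>0$ such that the following holds. Let $f\in C^\infty(\mathbb{T}^d)$ be real-valued, let $k\in\{1,\ldots,d\}$, let $g=\partial_k f$, and let $\bar x\in\mathbb{T}^d$ be such that $g(\bar x)=\max_{x\in\mathbb{T}^d}g(x)$. Then either $$g(\bar x)\le c\,\|f\|_{L^\infty}$$ or $$\Lambda^\alpha g(\bar x)\ \ge\ \frac{g(\bar x)^{1+\alpha}}{c\,\|f\|_{L^\infty}^\alpha}$$ holds.
   Context: $\mathbb{T}^d=[-\pi,\pi]^d$ is the periodic torus, and $C^\infty(\mathbb{T}^d)$ denotes smooth functions that are $2\pi$-periodic in each variable. $\Lambda^\alpha=(-\Delta)^{\alpha/2}$ on $\mathbb{T}^d$ is the Fourier multiplier with symbol $|k|^\alpha$, $k\in\mathbb{Z}^d$ (i.e. it multiplies the $k$-th Fourier coefficient by $|k|^\alpha$). *)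

theory Defs
  imports "HOL-Analysis.Analysis" "HOL-Probability.Essential_Supremum"
begin

text \<open>Functions on the torus are functions on the whole of \<open>real ^ 'n\<close> that are
  \<open>2 * pi\<close>-periodic in each variable; the dimension \<open>d\<close> is \<open>CARD('n)\<close>. The fundamental domain
  carries Lebesgue measure of total mass \<open>(2 * pi) ^ d\<close>.\<close>

definition torus :: "(real ^ 'n) set" where
  "torus = cbox (\<chi> i. - pi) (\<chi> i. pi)"

definition periodic_2pi :: "(real ^ 'n \<Rightarrow> 'b) \<Rightarrow> bool" where
  "periodic_2pi f \<longleftrightarrow> (\<forall>x i. f (x + axis i (2 * pi)) = f x)"

definition partial_deriv :: "'n \<Rightarrow> (real ^ 'n \<Rightarrow> real) \<Rightarrow> real ^ 'n \<Rightarrow> real" where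
  "partial_deriv k f x = deriv (\<lambda>t. f (x + t *\<^sub>R axis k 1)) 0"

primrec times_cont_diff :: "nat \<Rightarrow> (real ^ 'n \<Rightarrow> real) \<Rightarrow> bool" where
  "times_cont_diff 0 f \<longleftrightarrow> continuous_on UNIV f"
| "times_cont_diff (Suc m) f \<longleftrightarrow>
     (\<forall>x. f differentiable at x) \<and> (\<forall>k. times_cont_diff m (partial_deriv k f))"

definition smooth_torus :: "(real ^ 'n \<Rightarrow> real) \<Rightarrow> bool" where
  "smooth_torus f \<longleftrightarrow> (\<forall>m. times_cont_diff m f) \<and> periodic_2pi f"

text \<open>\<open>real_of_ereal\<close> maps infinite values to 0; for continuous \<open>f\<close> the essential supremum over
  the compact set \<open>torus\<close> is finite.\<close>

definition Linf_norm :: "(real ^ 'n \<Rightarrow> real) \<Rightarrow> real" where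
  "Linf_norm f = real_of_ereal (esssup (lebesgue_on torus) (\<lambda>x. ereal \<bar>f x\<bar>))"

definition freq :: "int ^ 'n \<Rightarrow> real ^ 'n" where
  "freq k = (\<chi> i. of_int (k $ i))"

definition fourier_coeff :: "(real ^ 'n \<Rightarrow> complex) \<Rightarrow> int ^ 'n \<Rightarrow> complex" where
  "fourier_coeff u k =
     (LINT x|lebesgue_on torus. u x * exp (- \<i> * of_real (freq k \<bullet> x))) / of_real ((2 * pi) ^ CARD('n))"

text \<open>The multiplier operator is given by its Fourier series, which converges absolutely
  for smooth \<open>u\<close>. For real-valued \<open>u\<close> its values are real, since \<open>k\<close> and \<open>- k\<close> contribute
  conjugate terms.\<close>

definition frac_laplacian :: "real \<Rightarrow> (real ^ 'n \<Rightarrow> complex) \<Rightarrow> real ^ 'n \<Rightarrow> complex" where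
  "frac_laplacian \<alpha> u x =
     (\<Sum>\<^sub>\<infinity>k\<in>UNIV. of_real (norm (freq k) powr \<alpha>) * fourier_coeff u k * exp (\<i> * of_real (freq k \<bullet> x)))"

end

theory Submission
  imports Defs "HOL-Probability.Characteristic_Functions"
begin

text \<open>
  The proof writes the fractional Laplacian through the heat flow. Put \<open>\<beta> = \<alpha> / 2\<close>. For \<open>s \<ge> 0\<close> a
  substitution gives \<open>A * s powr \<beta> = \<integral> (1 - exp (- t * s)) * t powr (- 1 - \<beta>) dt\<close> over \<open>t > 0\<close>, with a constant
  \<open>A > 0\<close> (\<open>frac_kernel_subordination\<close>). Taking \<open>s = |k|\<^sup>2\<close> and summing the Fourier series of \<open>g\<close> at \<open>xbar\<close>,
  one obtains \<open>A\<close> times the fractional Laplacian as the integral of \<open>(M - P t) * t powr (- 1 - \<beta>)\<close>, where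
  \<open>M = g xbar\<close> is the maximum of \<open>g\<close> and \<open>P t\<close> is the heat flow of \<open>g\<close> at time \<open>t\<close>, evaluated at \<open>xbar\<close>.

  The heat flow obeys two bounds. By the maximum principle \<open>P t \<le> M\<close> (\<open>heat_flow_le\<close>), so the
  integrand is non-negative. Since \<open>g\<close> is a derivative of \<open>f\<close>, the heat flow also satisfies
  \<open>P t \<le> N / sqrt (2 * t)\<close> with \<open>N\<close> the supremum norm of \<open>f\<close> (\<open>heat_flow_derivative_le\<close>). Hence
  \<open>P t \<le> M / 2\<close> for \<open>t \<ge> (2 * N / M)\<^sup>2\<close>, and integrating \<open>M / 2\<close> over these \<open>t\<close> yields a multiple of
  \<open>M powr (1 + \<alpha>) / N powr \<alpha>\<close>. If \<open>M \<le> 0\<close> or \<open>N = 0\<close>, the first alternative holds trivially.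

  Both heat flow bounds come from one-dimensional Gaussian averages, applied one coordinate after
  the other: the characteristic function of the normal distribution gives the multipliers, and
  Gaussian integration by parts gives the derivative bound.

  The link to the Fourier series definition is the absolutely convergent inversion formula
  \<open>fourier_inversion\<close>. It rests on the decay of the coefficients of smooth functions and on uniqueness,
  which follows from orthogonality of the characters and the Stone--Weierstrass theorem.
\<close>

section \<open>Periodicity, characters and orthogonality\<close>

lemma periodic_2pi_add_freq:
  fixes u :: "real ^ 'n \<Rightarrow> 'b"
  assumes "periodic_2pi u"
  shows "u (x + (2 * pi) *\<^sub>R freq m) = u x"
proof -
  have nat: "u (x + real n *\<^sub>R axis i (2 * pi)) = u x" for x i n
  proof (induction n arbitrary: x)
    case (Suc n)
    have "u (x + real (Suc n) *\<^sub>R axis i (2 * pi)) = u ((x + real n *\<^sub>R axis i (2 * pi)) + axis i (2 * pi))"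
      by (simp add: algebra_simps)
    then show ?case using assms Suc by (simp add: periodic_2pi_def)
  qed simp
  have int: "u (x + of_int z *\<^sub>R axis i (2 * pi)) = u x" for x i z
  proof (cases "z \<ge> 0")
    case True
    then show ?thesis using nat[of x "nat z" i] by simp
  next
    case False
    then show ?thesis using nat[of "x + of_int z *\<^sub>R axis i (2 * pi)" "nat (-z)" i] by simp
  qed
  have "u (x + (\<Sum>i\<in>A. of_int (m $ i) *\<^sub>R axis i (2 * pi))) = u x" if "finite A" for A
    using that
  proof (induction A arbitrary: x rule: finite_induct)
    case (insert j A)
    have "u (x + (\<Sum>i\<in>insert j A. of_int (m $ i) *\<^sub>R axis i (2 * pi)))
        = u ((x + of_int (m $ j) *\<^sub>R axis j (2 * pi)) + (\<Sum>i\<in>A. of_int (m $ i) *\<^sub>R axis i (2 * pi)))"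
      using insert by (simp add: add.assoc)
    also have "\<dots> = u x" using insert.IH int by simp
    finally show ?case .
  qed simp
  from this[of UNIV] have "u (x + (\<Sum>i\<in>UNIV. of_int (m $ i) *\<^sub>R axis i (2 * pi))) = u x" by simp
  moreover have "(\<Sum>i\<in>UNIV. of_int (m $ i) *\<^sub>R axis i (2 * pi)) = (2 * pi) *\<^sub>R freq m"
    by (simp add: vec_eq_iff freq_def axis_def if_distrib cong: if_cong)
  ultimately show ?thesis by simp
qed

lemma translate_into_torus:
  fixes x :: "real ^ 'n"
  obtains m where "x + (2 * pi) *\<^sub>R freq m \<in> torus"
proof
  let ?m = "\<chi> i. - \<lfloor>(x $ i + pi) / (2 * pi)\<rfloor>"
  have "- pi \<le> x $ i + 2 * pi * of_int (- \<lfloor>(x $ i + pi) / (2 * pi)\<rfloor>) \<and>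
      x $ i + 2 * pi * of_int (- \<lfloor>(x $ i + pi) / (2 * pi)\<rfloor>) \<le> pi" for i
  proof -
    define q where "q = (x $ i + pi) / (2 * pi)"
    have x: "x $ i = 2 * pi * q - pi" by (simp add: q_def)
    have "2 * pi * of_int \<lfloor>q\<rfloor> \<le> 2 * pi * q" "2 * pi * q \<le> 2 * pi * (of_int \<lfloor>q\<rfloor> + 1)"
      by (intro mult_left_mono; simp; linarith)+
    then show ?thesis unfolding q_def[symmetric] x by (simp add: algebra_simps)
  qed
  then show "x + (2 * pi) *\<^sub>R freq ?m \<in> torus"
    by (simp add: torus_def mem_box_cart freq_def)
qed

lemma compact_torus: "compact torus"
  by (simp add: torus_def)

lemma periodic_continuous_bounded:
  fixes u :: "real ^ 'n \<Rightarrow> 'b::real_normed_vector"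
  assumes "periodic_2pi u" "continuous_on UNIV u"
  obtains B where "B \<ge> 0" "\<And>x. norm (u x) \<le> B"
proof -
  have "compact (u ` torus)"
    using assms(2) compact_torus by (metis compact_continuous_image continuous_on_subset subset_UNIV)
  then obtain B where B: "\<And>y. y \<in> torus \<Longrightarrow> norm (u y) \<le> B"
    by (metis bounded_iff compact_imp_bounded imageI)
  have "norm (u x) \<le> \<bar>B\<bar>" for x
  proof -
    obtain m where "x + (2 * pi) *\<^sub>R freq m \<in> torus" by (rule translate_into_torus)
    then have "norm (u (x + (2 * pi) *\<^sub>R freq m)) \<le> B" by (rule B)
    then show ?thesis using periodic_2pi_add_freq[OF assms(1), of x m] by simp
  qed
  then show ?thesis using that[of "\<bar>B\<bar>"] by auto
qed

text \<open>The character with frequency \<open>k\<close>, that is \<open>x \<mapsto> exp (\<i> k \<bullet> x)\<close>.\<close>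

definition character :: "int ^ 'n \<Rightarrow> real ^ 'n \<Rightarrow> complex" where
  "character k x = exp (\<i> * of_real (freq k \<bullet> x))"

lemma character_cis: "character k x = cis (freq k \<bullet> x)"
  by (simp add: character_def cis_conv_exp)

lemma norm_character [simp]: "norm (character k x) = 1"
  by (simp add: character_cis)

lemma continuous_on_character [continuous_intros]: "continuous_on S (character k)"
  unfolding character_def by (intro continuous_intros)

lemma character_add: "character k (x + y) = character k x * character k y"
  by (simp add: character_cis inner_add_right cis_mult)

lemma freq_add: "freq (k + l) = freq k + freq l"
  by (simp add: freq_def vec_eq_iff)

lemma freq_uminus: "freq (- k) = - freq k"
  by (simp add: freq_def vec_eq_iff)

lemma freq_0 [simp]: "freq 0 = 0"
  by (simp add: freq_def vec_eq_iff)

lemma norm_freq_squared: "(norm (freq k))\<^sup>2 = (\<Sum>i\<in>UNIV. (of_int (k $ i))\<^sup>2)"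
  by (simp add: norm_vec_def L2_set_def freq_def sum_nonneg)

lemma freq_inner_axis: "freq k \<bullet> axis i s = of_int (k $ i) * s"
  by (simp add: inner_axis freq_def)

lemma character_mult: "character k x * character l x = character (k + l) x"
  by (simp add: character_cis freq_add inner_add_left cis_mult)

lemma character_0 [simp]: "character 0 x = 1"
  by (simp add: character_cis)

lemma character_axis: "character k (s *\<^sub>R axis j 1) = cis (of_int (k $ j) * s)"
  by (simp add: character_cis freq_inner_axis mult.commute)

lemma periodic_character: "periodic_2pi (character k)"
proof -
  have "cis (of_int m * (2 * pi)) = 1" for m
    using cis_multiple_2pi[of "of_int m"] by (simp add: mult.commute)
  then show ?thesis
    unfolding periodic_2pi_def character_add by (simp add: character_cis freq_inner_axis)
qed

text \<open>Fubini for a product of functions of the single coordinates. Lebesgue measure on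
  \<open>real ^ 'n\<close> is the image of a product measure indexed by the standard basis.\<close>

lemma integral_lborel_prod_components:
  fixes h :: "'n::finite \<Rightarrow> real \<Rightarrow> complex"
  assumes h: "\<And>i. integrable lborel (h i)"
  shows "(\<integral>x. (\<Prod>i\<in>UNIV. h i (x $ i)) \<partial>(lborel :: (real ^ 'n) measure)) = (\<Prod>i\<in>UNIV. integral\<^sup>L lborel (h i))"
proof -
  interpret product_sigma_finite "\<lambda>_::real^'n. lborel :: real measure"
    by (simp add: lborel.sigma_finite_measure_axioms product_sigma_finite_def)
  have [measurable]: "h i \<in> borel_measurable borel" for i
    using h[of i] by (simp add: borel_measurable_integrable)
  have B: "(Basis :: (real^'n) set) = range (\<lambda>i. axis i 1)"
    by (auto simp: Basis_vec_def)
  have inj: "inj (\<lambda>i::'n. axis i (1::real))"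
    by (auto simp: inj_on_def axis_eq_axis)
  have re: "(\<Prod>i\<in>UNIV. H i) = (\<Prod>b\<in>(Basis :: (real^'n) set). H (axis_index b))" for H :: "'n \<Rightarrow> complex"
    unfolding B prod.reindex[OF inj] by (simp add: o_def axis_index_axis)
  have comp: "(\<Sum>b\<in>Basis. f b *\<^sub>R b) $ i = f (axis i 1)" for f :: "real^'n \<Rightarrow> real" and i
    unfolding B sum.reindex[OF inj] by (simp add: axis_def if_distrib cong: if_cong)
  have "(\<integral>x. (\<Prod>i\<in>UNIV. h i (x $ i)) \<partial>(lborel :: (real ^ 'n) measure))
      = (\<integral>f. (\<Prod>i\<in>UNIV. h i ((\<Sum>b\<in>Basis. f b *\<^sub>R b) $ i)) \<partial>(\<Pi>\<^sub>M b\<in>(Basis :: (real^'n) set). lborel))"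
    by (subst lborel_eq, subst integral_distr) auto
  also have "\<dots> = (\<integral>f. (\<Prod>b\<in>Basis. h (axis_index b) (f b)) \<partial>(\<Pi>\<^sub>M b\<in>(Basis :: (real^'n) set). lborel))"
    unfolding comp by (subst re) (rule Bochner_Integration.integral_cong[OF refl],
      auto intro!: prod.cong simp: B axis_index_axis)
  also have "\<dots> = (\<Prod>b\<in>(Basis :: (real^'n) set). integral\<^sup>L lborel (h (axis_index b)))"
    by (rule product_integral_prod) (use h in auto)
  also have "\<dots> = (\<Prod>i\<in>UNIV. integral\<^sup>L lborel (h i))"
    by (subst re) simp
  finally show ?thesis .
qed

lemma integral_cis_period:
  "(\<integral>s. indicator {-pi..pi} s *\<^sub>R cis (of_int m * s) \<partial>lborel) = (if m = 0 then of_real (2 * pi) else 0)"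
proof (cases "m = 0")
  case False
  have "(\<integral>s. indicator {-pi..pi} s *\<^sub>R cis (of_int m * s) \<partial>lborel)
      = cis (of_int m * pi) / (\<i> * of_int m) - cis (of_int m * (-pi)) / (\<i> * of_int m)"
  proof (rule integral_FTC_atLeastAtMost)
    show "((\<lambda>s. cis (of_int m * s) / (\<i> * of_int m)) has_vector_derivative cis (of_int m * x)) (at x within {-pi..pi})" for x
      unfolding cis_conv_exp using False
      by (auto intro!: derivative_eq_intros has_vector_derivative_real_field simp: field_simps)
    show "continuous_on {- pi..pi} (\<lambda>s. cis (of_int m * s))" by (intro continuous_intros)
  qed simp
  also have "cis (of_int m * pi) = cis (of_int m * (-pi)) * cis (2 * pi * of_int m)"
    by (simp add: cis_mult algebra_simps)
  also have "cis (2 * pi * of_int m) = 1" by (rule cis_multiple_2pi) simp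
  finally show ?thesis using False by simp
qed (simp add: scaleR_conv_of_real)

lemma integral_torus_character:
  "(LINT x|lebesgue_on torus. character (k :: int ^ 'n) x) = (if k = 0 then of_real ((2 * pi) ^ CARD('n)) else 0)"
proof -
  let ?h = "\<lambda>i s. indicator {-pi..pi} s *\<^sub>R cis (of_int (k $ i) * s)"
  have h: "integrable lborel (?h i)" for i
    by (rule borel_integrable_compact) (auto intro!: continuous_intros)
  have [measurable]: "(torus :: (real^'n) set) \<in> sets borel" by (simp add: torus_def)
  have [measurable]: "character k \<in> borel_measurable borel"
    by (intro borel_measurable_continuous_onI continuous_intros)
  have ind: "indicator torus x *\<^sub>R character k x = (\<Prod>i\<in>UNIV. ?h i (x $ i))" for x :: "real ^ 'n"
  proof -
    have "cis (sum t A) = (\<Prod>i\<in>A. cis (t i))" if "finite A" for t and A :: "'n set"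
      using that by (induction rule: finite_induct) (auto simp: cis_mult[symmetric])
    then have "character k x = (\<Prod>i\<in>UNIV. cis (of_int (k $ i) * x $ i))"
      by (simp add: character_cis inner_vec_def freq_def)
    moreover have "(indicator torus x :: complex) = (\<Prod>i\<in>UNIV. indicator {-pi..pi} (x $ i))"
      by (auto simp: torus_def mem_box_cart indicator_def prod_zero_iff)
    ultimately show ?thesis by (simp add: scaleR_conv_of_real prod.distrib of_real_indicator)
  qed
  have "(LINT x|lebesgue_on torus. character k x) = (LINT x|lebesgue. indicator torus x *\<^sub>R character k x)"
    by (rule integral_restrict_space) simp
  also have "\<dots> = (LINT x|lborel. indicator torus x *\<^sub>R character k x)"
    by (rule integral_completion) measurable
  also have "\<dots> = (\<Prod>i\<in>UNIV. integral\<^sup>L lborel (?h i))"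
    unfolding ind by (rule integral_lborel_prod_components) (rule h)
  also have "\<dots> = (\<Prod>i\<in>UNIV. if k $ i = 0 then of_real (2 * pi) else 0)"
    unfolding integral_cis_period ..
  also have "\<dots> = (if k = 0 then of_real ((2 * pi) ^ CARD('n)) else 0)"
    by (auto simp: vec_eq_iff)
  finally show ?thesis .
qed

section \<open>Density of trigonometric polynomials\<close>

text \<open>Trigonometric polynomials: finite linear combinations of characters with complex coefficients.\<close>

inductive trig_poly :: "(real ^ 'n \<Rightarrow> complex) \<Rightarrow> bool" where
  monomial: "trig_poly (\<lambda>x. c * character k x)"
| add: "trig_poly p \<Longrightarrow> trig_poly q \<Longrightarrow> trig_poly (\<lambda>x. p x + q x)"

lemma trig_poly_const: "trig_poly (\<lambda>x. c)"
  using trig_poly.monomial[of c 0] by simp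

lemma trig_poly_sum:
  assumes "finite A" "\<And>i. i \<in> A \<Longrightarrow> trig_poly (p i)"
  shows "trig_poly (\<lambda>x. \<Sum>i\<in>A. p i x)"
  using assms by (induction rule: finite_induct) (auto intro: trig_poly_const trig_poly.add)

lemma trig_poly_mult:
  assumes "trig_poly p" "trig_poly q"
  shows "trig_poly (\<lambda>x. p x * q x)"
  using assms(1)
proof induction
  case (monomial c k)
  show ?case using assms(2)
  proof induction
    case (monomial d l)
    have "(\<lambda>x. c * character k x * (d * character l x)) = (\<lambda>x. (c * d) * character (k + l) x)"
      by (auto simp: character_mult[symmetric])
    then show ?case by (simp only: trig_poly.monomial)
  next
    case (add p q)
    then show ?case by (simp add: distrib_left trig_poly.add)
  qed
next
  case (add p q)
  then show ?case by (simp add: distrib_right trig_poly.add)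
qed

lemma trig_poly_continuous: "trig_poly p \<Longrightarrow> continuous_on S p"
  by (induction rule: trig_poly.induct) (auto intro!: continuous_intros)

lemma trig_poly_coordinate:
  "trig_poly (\<lambda>x. of_real (cos (x $ i)))" "trig_poly (\<lambda>x. of_real (sin (x $ i)))"
proof -
  let ?e = "axis i 1 :: int ^ 'a"
  have e: "character ?e x = cis (x $ i)" "character (- ?e) x = cis (- x $ i)" for x
  proof -
    have "freq ?e = axis i 1" by (simp add: freq_def vec_eq_iff axis_def)
    then show "character ?e x = cis (x $ i)" "character (- ?e) x = cis (- x $ i)"
      by (simp_all add: character_cis freq_uminus inner_axis')
  qed
  have "(\<lambda>x. of_real (cos (x $ i))) = (\<lambda>x. 1/2 * character ?e x + 1/2 * character (- ?e) x)"
    by (auto simp: e complex_eq_iff)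
  then show "trig_poly (\<lambda>x. of_real (cos (x $ i)))"
    by (simp only:) (intro trig_poly.intros)
  have "(\<lambda>x. of_real (sin (x $ i))) = (\<lambda>x. (-\<i>/2) * character ?e x + (\<i>/2) * character (- ?e) x)"
    by (auto simp: e complex_eq_iff)
  then show "trig_poly (\<lambda>x. of_real (sin (x $ i)))"
    by (simp only:) (intro trig_poly.intros)
qed

text \<open>Polynomials in the real and imaginary parts of the \<open>cis (x $ i)\<close> are trigonometric polynomials
  in \<open>x\<close>. This turns polynomial approximation on the embedded torus in \<open>complex ^ 'n\<close> into
  trigonometric approximation.\<close>

lemma trig_poly_polynomial:
  fixes P :: "complex ^ 'n \<Rightarrow> real"
  assumes "real_polynomial_function P"
  shows "trig_poly (\<lambda>x :: real ^ 'n. of_real (P (\<chi> i. cis (x $ i))))"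
  using assms
proof induction
  case (linear f)
  interpret bounded_linear f by fact
  have "f (\<chi> i. cis (x $ i)) = (\<Sum>i\<in>UNIV. cos (x $ i) * f (axis i 1) + sin (x $ i) * f (axis i \<i>))" for x :: "real ^ 'n"
  proof -
    have "(\<chi> i. cis (x $ i)) = (\<Sum>i\<in>UNIV. cos (x $ i) *\<^sub>R axis i 1 + sin (x $ i) *\<^sub>R axis i \<i>)"
      by (simp add: vec_eq_iff axis_def if_distrib sum.distrib complex_eq_iff cong: if_cong)
    then show ?thesis by (simp add: sum add scaleR)
  qed
  then have "(\<lambda>x :: real ^ 'n. of_real (f (\<chi> i. cis (x $ i))) :: complex)
      = (\<lambda>x. \<Sum>i\<in>UNIV. of_real (cos (x $ i)) * of_real (f (axis i 1)) + of_real (sin (x $ i)) * of_real (f (axis i \<i>)))"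
    by simp
  then show ?case
    by (simp only:) (intro trig_poly_sum trig_poly.add trig_poly_mult trig_poly_coordinate trig_poly_const finite)
qed (auto intro: trig_poly_const trig_poly.add trig_poly_mult)

lemma periodic_eq_of_cis_eq:
  fixes u :: "real ^ 'n \<Rightarrow> 'b"
  assumes "periodic_2pi u" and eq: "(\<chi> i. cis (x $ i)) = (\<chi> i. cis (y $ i))"
  shows "u x = u y"
proof -
  have "\<exists>m::int. x $ i = y $ i + 2 * pi * of_int m" for i
  proof -
    have "cis (x $ i) = cis (y $ i)" using eq by (simp add: vec_eq_iff)
    then have "sin (x $ i) = sin (y $ i) \<and> cos (x $ i) = cos (y $ i)" by (simp add: complex_eq_iff)
    then show ?thesis by (metis sin_cos_eq_iff)
  qed
  then obtain m where "\<And>i. x $ i = y $ i + 2 * pi * of_int (m i)" by metis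
  then have "x = y + (2 * pi) *\<^sub>R freq (\<chi> i. m i)" by (simp add: vec_eq_iff freq_def)
  then show ?thesis using periodic_2pi_add_freq[OF assms(1)] by simp
qed

text \<open>A continuous periodic function factors through the embedding \<open>x \<mapsto> (cis (x $ i))\<^sub>i\<close> of the torus
  into \<open>complex ^ 'n\<close>; the factor is continuous on the compact image, where the
  Stone--Weierstrass theorem applies.\<close>

lemma trig_poly_dense_real:
  fixes u :: "real ^ 'n \<Rightarrow> real"
  assumes per: "periodic_2pi u" and cont: "continuous_on UNIV u" and "\<epsilon> > 0"
  obtains p where "trig_poly p" "\<And>x. norm (of_real (u x) - p x) < \<epsilon>"
proof -
  define E where "E = (\<lambda>x :: real ^ 'n. \<chi> i. cis (x $ i))"
  define K where "K = E ` torus"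
  define U where "U = (\<lambda>z. u (SOME x. E x = z))"
  have U: "U (E x) = u x" for x
  proof -
    have "E (SOME y. E y = E x) = E x" by (rule someI) simp
    then show ?thesis unfolding U_def by (intro periodic_eq_of_cis_eq[OF per]) (simp add: E_def)
  qed
  have contE: "continuous_on S E" for S
    unfolding E_def by (intro continuous_intros)
  have K: "compact K"
    unfolding K_def by (intro compact_continuous_image contE compact_torus)
  have EK: "E x \<in> K" for x
  proof -
    obtain m where "x + (2 * pi) *\<^sub>R freq m \<in> torus" by (rule translate_into_torus)
    moreover have "E (x + (2 * pi) *\<^sub>R freq m) = E x"
      by (rule periodic_2pi_add_freq) (auto simp: periodic_2pi_def E_def vec_eq_iff axis_def cis_mult[symmetric])
    ultimately show ?thesis unfolding K_def by (metis imageI)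
  qed
  \<comment> \<open>\<open>E\<close> maps compact sets to compact sets, so preimages of closed sets under \<open>U\<close> are closed.\<close>
  have "continuous_on K U"
    unfolding continuous_on_closed_vimage[OF compact_imp_closed[OF K]]
  proof (intro allI impI)
    fix B :: "real set" assume "closed B"
    then have "closed (u -` B)" using cont by (simp add: continuous_on_closed_vimage)
    then have "compact (E ` (torus \<inter> u -` B))"
      by (intro compact_continuous_image contE compact_Int_closed compact_torus)
    moreover have "U -` B \<inter> K = E ` (torus \<inter> u -` B)"
      by (auto simp: K_def U)
    ultimately show "closed (U -` B \<inter> K)" by (simp add: compact_imp_closed)
  qed
  then obtain P where P: "real_polynomial_function P" "\<And>z. z \<in> K \<Longrightarrow> \<bar>U z - P z\<bar> < \<epsilon>"
    using Stone_Weierstrass_real_polynomial_function[OF K] \<open>\<epsilon> > 0\<close> by metis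
  show ?thesis
  proof
    show "trig_poly (\<lambda>x. of_real (P (E x)))"
      unfolding E_def by (rule trig_poly_polynomial[OF P(1)])
    show "norm (of_real (u x) - of_real (P (E x)) :: complex) < \<epsilon>" for x
      using P(2)[OF EK[of x]] by (simp add: U flip: of_real_diff)
  qed
qed

lemma trig_poly_dense:
  fixes u :: "real ^ 'n \<Rightarrow> complex"
  assumes per: "periodic_2pi u" and cont: "continuous_on UNIV u" and "\<epsilon> > 0"
  obtains p where "trig_poly p" "\<And>x. norm (u x - p x) < \<epsilon>"
proof -
  obtain p where p: "trig_poly p" "\<And>x. norm (of_real (Re (u x)) - p x) < \<epsilon> / 2"
    by (rule trig_poly_dense_real[of "\<lambda>x. Re (u x)" "\<epsilon> / 2"])
      (use assms in \<open>auto simp: periodic_2pi_def intro!: continuous_intros\<close>)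
  obtain q where q: "trig_poly q" "\<And>x. norm (of_real (Im (u x)) - q x) < \<epsilon> / 2"
    by (rule trig_poly_dense_real[of "\<lambda>x. Im (u x)" "\<epsilon> / 2"])
      (use assms in \<open>auto simp: periodic_2pi_def intro!: continuous_intros\<close>)
  show ?thesis
  proof
    show "trig_poly (\<lambda>x. p x + \<i> * q x)"
      by (intro trig_poly.add trig_poly_mult trig_poly_const p q)
    fix x
    have "u x - (p x + \<i> * q x) = (of_real (Re (u x)) - p x) + \<i> * (of_real (Im (u x)) - q x)"
      by (subst complex_eq[of "u x"]) (simp add: algebra_simps)
    also have "norm \<dots> \<le> norm (of_real (Re (u x)) - p x) + norm (of_real (Im (u x)) - q x)"
      by (rule order_trans[OF norm_triangle_ineq]) (simp add: norm_mult)
    also have "\<dots> < \<epsilon>" using p(2)[of x] q(2)[of x] by simp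
    finally show "norm (u x - (p x + \<i> * q x)) < \<epsilon>" .
  qed
qed

lemma integrable_torus:
  fixes u :: "real ^ 'n \<Rightarrow> 'b::euclidean_space"
  assumes "continuous_on UNIV u"
  shows "integrable (lebesgue_on torus) u"
  unfolding torus_def by (rule continuous_imp_integrable) (use assms continuous_on_subset in blast)

lemma measure_torus:
  "measure (lebesgue_on (torus :: (real ^ 'n) set)) torus = (2 * pi) ^ CARD('n)"
proof -
  have "measure (lebesgue_on (torus :: (real ^ 'n) set)) torus = measure lebesgue (torus :: (real ^ 'n) set)"
    by (simp add: measure_restrict_space torus_def)
  also have "\<dots> = (2 * pi) ^ CARD('n)"
    unfolding torus_def by (simp add: content_cbox_if_cart interval_eq_empty_cart)
  finally show ?thesis .
qed

lemma norm_integral_torus_le: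
  fixes u :: "real ^ 'n \<Rightarrow> complex"
  assumes "continuous_on UNIV u" "\<And>x. norm (u x) \<le> B"
  shows "norm (LINT x|lebesgue_on torus. u x) \<le> (2 * pi) ^ CARD('n) * B"
proof -
  have "norm (LINT x|lebesgue_on torus. u x) \<le> (LINT x|lebesgue_on torus. norm (u x))"
    by (rule integral_norm_bound)
  also have "\<dots> \<le> (LINT x|lebesgue_on (torus :: (real ^ 'n) set). B)"
    by (intro integral_mono integrable_torus) (use assms in \<open>auto intro!: continuous_intros\<close>)
  also have "\<dots> = (2 * pi) ^ CARD('n) * B"
    using measure_torus[where 'n='n] by simp
  finally show ?thesis .
qed

text \<open>The integral over a period is translation invariant. For characters this is orthogonality,
  and uniform approximation carries it to continuous functions.\<close>

lemma integral_torus_translate: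
  fixes u :: "real ^ 'n \<Rightarrow> complex"
  assumes per: "periodic_2pi u" and cont: "continuous_on UNIV u"
  shows "(LINT x|lebesgue_on torus. u (x + a)) = (LINT x|lebesgue_on torus. u x)"
proof -
  have trig: "(LINT x|lebesgue_on torus. p (x + a)) = (LINT x|lebesgue_on torus. p x)" if "trig_poly p" for p :: "real ^ 'n \<Rightarrow> complex"
    using that
  proof induction
    case (monomial c k)
    then show ?case
      by (auto simp: character_add integral_torus_character)
  next
    case (add p q)
    have i: "integrable (lebesgue_on torus) r" "integrable (lebesgue_on torus) (\<lambda>x. r (x + a))"
      if "trig_poly r" for r :: "real ^ 'n \<Rightarrow> complex"
    proof -
      show "integrable (lebesgue_on torus) r" by (intro integrable_torus trig_poly_continuous that)
      have "continuous_on UNIV (\<lambda>x. r (x + a))"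
        by (rule continuous_on_compose2[OF trig_poly_continuous[OF that, of UNIV]]) (auto intro!: continuous_intros)
      then show "integrable (lebesgue_on torus) (\<lambda>x. r (x + a))" by (rule integrable_torus)
    qed
    show ?case
      using add i[OF add.hyps(1)] i[OF add.hyps(2)] by (simp add: Bochner_Integration.integral_add)
  qed
  let ?V = "(2 * pi) ^ CARD('n)"
  let ?D = "(LINT x|lebesgue_on torus. u (x + a)) - (LINT x|lebesgue_on torus. u x)"
  have conta: "continuous_on UNIV (\<lambda>x. w (x + a))" if "continuous_on UNIV w" for w :: "real ^ 'n \<Rightarrow> complex"
    by (rule continuous_on_compose2[OF that]) (auto intro!: continuous_intros)
  have "norm ?D \<le> \<epsilon>" if "\<epsilon> > 0" for \<epsilon>
  proof -
    define \<delta> where "\<delta> = \<epsilon> / (2 * ?V)"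
    have "\<delta> > 0" using that by (simp add: \<delta>_def)
    then obtain p where p: "trig_poly p" "\<And>x. norm (u x - p x) < \<delta>"
      using trig_poly_dense[OF per cont] by metis
    note pc = trig_poly_continuous[OF p(1), of UNIV]
    have "norm (LINT x|lebesgue_on torus. u (x + a) - p (x + a)) \<le> ?V * \<delta>"
      by (intro norm_integral_torus_le continuous_intros conta cont pc less_imp_le p)
    moreover have "norm (LINT x|lebesgue_on torus. u x - p x) \<le> ?V * \<delta>"
      by (intro norm_integral_torus_le continuous_intros cont pc less_imp_le p)
    moreover have "?D = (LINT x|lebesgue_on torus. u (x + a) - p (x + a)) - (LINT x|lebesgue_on torus. u x - p x)"
      using trig[OF p(1)]
      by (simp add: Bochner_Integration.integral_diff integrable_torus conta cont pc)
    ultimately have "norm ?D \<le> ?V * \<delta> + ?V * \<delta>"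
      by (simp only:) (rule order_trans[OF norm_triangle_ineq4 add_mono])
    also have "\<dots> = \<epsilon>" by (simp add: \<delta>_def)
    finally show ?thesis .
  qed
  then have "norm ?D \<le> 0" using field_le_epsilon[of "norm ?D" 0] by simp
  then show ?thesis by simp
qed

section \<open>Fourier coefficients of smooth functions\<close>

lemma fourier_coeff_character:
  "fourier_coeff u k = (LINT x|lebesgue_on torus. u x * character (- k) x) / of_real ((2 * pi) ^ CARD('n))"
  for u :: "real ^ 'n \<Rightarrow> complex"
  by (simp add: fourier_coeff_def character_def freq_uminus)

lemma fourier_coeff_diff:
  assumes "continuous_on UNIV u" "continuous_on UNIV v"
  shows "fourier_coeff (\<lambda>x. u x - v x) k = fourier_coeff u k - fourier_coeff v k"
proof -
  have "integrable (lebesgue_on torus) (\<lambda>x. u x * character (- k) x)"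
    "integrable (lebesgue_on torus) (\<lambda>x. v x * character (- k) x)"
    by (intro integrable_torus continuous_intros assms)+
  then show ?thesis
    unfolding fourier_coeff_character by (simp add: left_diff_distrib Bochner_Integration.integral_diff diff_divide_distrib)
qed

lemma norm_fourier_coeff_le:
  assumes "continuous_on UNIV u" "\<And>x. norm (u x) \<le> B"
  shows "norm (fourier_coeff u k) \<le> B"
proof -
  have "norm (LINT x|lebesgue_on torus. u x * character (- k) x) \<le> (2 * pi) ^ CARD('a) * B"
    by (intro norm_integral_torus_le continuous_intros assms) (simp add: norm_mult assms)
  then show ?thesis
    unfolding fourier_coeff_character by (simp only: norm_divide norm_of_real) (simp add: pos_divide_le_eq mult.commute)
qed

lemma fourier_coeff_translate:
  assumes "periodic_2pi u" "continuous_on UNIV u"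
  shows "fourier_coeff (\<lambda>x. u (x + a)) k = character k a * fourier_coeff u k"
proof -
  have "character k a * character (- k) a = 1" by (simp add: character_mult)
  then have "u (x + a) * character (- k) x = character k a * (u (x + a) * character (- k) (x + a))" for x
    by (simp add: character_add)
  then have "(LINT x|lebesgue_on torus. u (x + a) * character (- k) x)
     = (LINT x|lebesgue_on torus. character k a * (u (x + a) * character (- k) (x + a)))"
    by (rule Bochner_Integration.integral_cong[OF refl])
  also have "\<dots> = character k a * (LINT x|lebesgue_on torus. u (x + a) * character (- k) (x + a))"
    by simp
  also have "(LINT x|lebesgue_on torus. u (x + a) * character (- k) (x + a)) = (LINT x|lebesgue_on torus. u x * character (- k) x)"
    by (rule integral_torus_translate[where u = "\<lambda>x. u x * character (- k) x"])
      (use assms periodic_character[of "- k"] in \<open>auto simp: periodic_2pi_def intro!: continuous_intros\<close>)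
  finally show ?thesis unfolding fourier_coeff_character by simp
qed

lemma smooth_torus_differentiable: "smooth_torus f \<Longrightarrow> f differentiable at x"
  unfolding smooth_torus_def by (metis times_cont_diff.simps(2))

lemma smooth_torus_continuous: "smooth_torus f \<Longrightarrow> continuous_on UNIV f"
  unfolding smooth_torus_def by (metis times_cont_diff.simps(1))

lemma smooth_torus_periodic: "smooth_torus f \<Longrightarrow> periodic_2pi f"
  unfolding smooth_torus_def by simp

lemma smooth_torus_partial_deriv:
  assumes "smooth_torus f"
  shows "smooth_torus (partial_deriv j f)"
proof -
  have "times_cont_diff m (partial_deriv j f)" for m
    using assms unfolding smooth_torus_def by (metis times_cont_diff.simps(2))
  moreover have "periodic_2pi (partial_deriv j f)"
    unfolding periodic_2pi_def partial_deriv_def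
  proof (intro allI)
    fix x i
    have "(\<lambda>t. f (x + axis i (2 * pi) + t *\<^sub>R axis j 1)) = (\<lambda>t. f (x + t *\<^sub>R axis j 1))"
      using smooth_torus_periodic[OF assms] unfolding periodic_2pi_def
      by (metis (no_types, lifting) add.assoc add.commute)
    then show "deriv (\<lambda>t. f (x + axis i (2 * pi) + t *\<^sub>R axis j 1)) 0 = deriv (\<lambda>t. f (x + t *\<^sub>R axis j 1)) 0"
      by simp
  qed
  ultimately show ?thesis unfolding smooth_torus_def by simp
qed

text \<open>Since \<open>partial_deriv\<close> is given by the total function \<open>deriv\<close>, differentiability is needed for it
  to be the derivative along the coordinate line.\<close>

lemma partial_deriv_has_derivative:
  assumes "\<And>x. f differentiable at x"
  shows "((\<lambda>t. f (x + t *\<^sub>R axis j 1)) has_real_derivative partial_deriv j f (x + s *\<^sub>R axis j 1)) (at s)"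
proof -
  have d: "(\<lambda>t. f (y + t *\<^sub>R axis j 1)) differentiable at r" for y r
    by (rule differentiable_compose[of f]) (use assms in \<open>auto intro!: derivative_intros\<close>)
  have "((\<lambda>t. f (y + t *\<^sub>R axis j 1)) has_real_derivative partial_deriv j f y) (at 0)" for y
    unfolding partial_deriv_def using d[of y 0]
    by (simp add: DERIV_deriv_iff_real_differentiable)
  from this[of "x + s *\<^sub>R axis j 1"]
  have "((\<lambda>t. f (x + (s + t) *\<^sub>R axis j 1)) has_real_derivative partial_deriv j f (x + s *\<^sub>R axis j 1)) (at 0)"
    by (simp add: scaleR_add_left add.assoc)
  then show ?thesis
    using DERIV_at_within_shift[of "\<lambda>t. f (x + t *\<^sub>R axis j 1)" "partial_deriv j f (x + s *\<^sub>R axis j 1)" s 0 UNIV] by simp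
qed

lemma times_cont_diff_diff:
  "times_cont_diff m f \<Longrightarrow> times_cont_diff m g \<Longrightarrow> times_cont_diff m (\<lambda>x. f x - g x)"
proof (induction m arbitrary: f g)
  case 0
  then show ?case by (auto intro: continuous_intros)
next
  case (Suc m)
  have "partial_deriv k (\<lambda>x. f x - g x) = (\<lambda>x. partial_deriv k f x - partial_deriv k g x)" for k
  proof
    fix x
    have "((\<lambda>t. f (x + t *\<^sub>R axis k 1) - g (x + t *\<^sub>R axis k 1)) has_real_derivative
       (partial_deriv k f (x + 0 *\<^sub>R axis k 1) - partial_deriv k g (x + 0 *\<^sub>R axis k 1))) (at 0)"
      by (intro DERIV_diff partial_deriv_has_derivative) (use Suc.prems in auto)
    then show "partial_deriv k (\<lambda>x. f x - g x) x = partial_deriv k f x - partial_deriv k g x"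
      unfolding partial_deriv_def[of k "\<lambda>x. f x - g x"] by (simp add: DERIV_imp_deriv)
  qed
  then show ?case using Suc by (auto intro!: differentiable_diff)
qed

lemma smooth_torus_diff: "smooth_torus f \<Longrightarrow> smooth_torus g \<Longrightarrow> smooth_torus (\<lambda>x. f x - g x)"
  unfolding smooth_torus_def by (auto simp: times_cont_diff_diff periodic_2pi_def)

text \<open>Instead of integrating by parts, the coefficients of the difference quotients in direction \<open>j\<close>
  are computed from translation invariance; dominated convergence gives the limit.\<close>

lemma fourier_coeff_partial_deriv:
  fixes f :: "real ^ 'n \<Rightarrow> real"
  assumes f: "smooth_torus f"
  shows "fourier_coeff (\<lambda>x. of_real (partial_deriv j f x)) k
    = \<i> * of_int (k $ j) * fourier_coeff (\<lambda>x. of_real (f x)) k"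
proof -
  define h :: "nat \<Rightarrow> real" where "h n = inverse (real (Suc n))" for n
  have h: "h n > 0" for n by (simp add: h_def)
  have h0: "filterlim h (at 0) sequentially"
    unfolding filterlim_at using LIMSEQ_inverse_real_of_nat h by (auto simp: h_def[abs_def])
  define D where "D n x = (f (x + h n *\<^sub>R axis j 1) - f x) / h n" for n x
  note cont = smooth_torus_continuous[OF f]
  note der = partial_deriv_has_derivative[OF smooth_torus_differentiable[OF f]]
  have contD: "continuous_on UNIV (D n)" for n
    unfolding D_def using h[of n]
    by (intro continuous_intros cont continuous_on_compose2[OF cont]) auto
  have g: "smooth_torus (partial_deriv j f)" by (rule smooth_torus_partial_deriv[OF f])
  obtain B where B: "\<And>x. \<bar>partial_deriv j f x\<bar> \<le> B"
    using periodic_continuous_bounded[OF smooth_torus_periodic[OF g] smooth_torus_continuous[OF g]] by auto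
  have D_lim: "(\<lambda>n. D n x) \<longlonglongrightarrow> partial_deriv j f x" for x
  proof -
    have "((\<lambda>y. (f (x + y *\<^sub>R axis j 1) - f x) / y) \<longlongrightarrow> partial_deriv j f x) (at 0)"
      using der[of x j 0] by (simp add: has_field_derivative_iff)
    from filterlim_compose[OF this h0] show ?thesis by (simp add: D_def)
  qed
  have D_bound: "\<bar>D n x\<bar> \<le> B" for n x
  proof -
    obtain z where "f (x + h n *\<^sub>R axis j 1) - f (x + 0 *\<^sub>R axis j 1) = (h n - 0) * partial_deriv j f (x + z *\<^sub>R axis j 1)"
      using MVT2[OF h[of n], of "\<lambda>t. f (x + t *\<^sub>R axis j 1)" "\<lambda>z. partial_deriv j f (x + z *\<^sub>R axis j 1)"] der by blast
    then have "D n x = partial_deriv j f (x + z *\<^sub>R axis j 1)"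
      using h[of n] by (simp add: D_def field_simps)
    then show ?thesis using B by simp
  qed
  have coeffD: "fourier_coeff (\<lambda>x. of_real (D n x)) k
      = (cis (of_int (k $ j) * h n) - 1) / of_real (h n) * fourier_coeff (\<lambda>x. of_real (f x)) k" for n
  proof -
    let ?u = "\<lambda>x. complex_of_real (f x)"
    have u: "periodic_2pi ?u" "continuous_on UNIV ?u"
      using smooth_torus_periodic[OF f] by (auto simp: periodic_2pi_def intro!: continuous_intros cont)
    have "fourier_coeff (\<lambda>x. of_real (D n x)) k
       = fourier_coeff (\<lambda>x. ?u (x + h n *\<^sub>R axis j 1) - ?u x) k / of_real (h n)"
      unfolding fourier_coeff_def D_def by simp
    also have "fourier_coeff (\<lambda>x. ?u (x + h n *\<^sub>R axis j 1) - ?u x) k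
       = fourier_coeff (\<lambda>x. ?u (x + h n *\<^sub>R axis j 1)) k - fourier_coeff ?u k"
      by (intro fourier_coeff_diff u continuous_on_compose2[OF u(2)] continuous_intros) auto
    also have "fourier_coeff (\<lambda>x. ?u (x + h n *\<^sub>R axis j 1)) k = cis (of_int (k $ j) * h n) * fourier_coeff ?u k"
      by (subst fourier_coeff_translate[OF u]) (simp add: character_axis)
    finally show ?thesis by (simp add: algebra_simps)
  qed
  have "(\<lambda>n. (cis (of_int (k $ j) * h n) - 1) / of_real (h n)) \<longlonglongrightarrow> \<i> * of_int (k $ j)"
  proof -
    have "((\<lambda>z. exp (\<i> * of_int (k $ j) * z)) has_field_derivative \<i> * of_int (k $ j)) (at 0)"
      by (auto intro!: derivative_eq_intros)
    then have "((\<lambda>z. (exp (\<i> * of_int (k $ j) * z) - 1) / z) \<longlongrightarrow> \<i> * of_int (k $ j)) (at 0)"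
      by (simp add: has_field_derivative_iff)
    moreover have "filterlim (\<lambda>n. complex_of_real (h n)) (at 0) sequentially"
      using h0 h unfolding filterlim_at by (auto intro!: tendsto_eq_intros simp: less_imp_neq[symmetric])
    ultimately have "(\<lambda>n. (exp (\<i> * of_int (k $ j) * of_real (h n)) - 1) / of_real (h n)) \<longlonglongrightarrow> \<i> * of_int (k $ j)"
      by (rule filterlim_compose)
    then show ?thesis by (simp add: cis_conv_exp mult.assoc)
  qed
  then have 1: "(\<lambda>n. fourier_coeff (\<lambda>x. of_real (D n x)) k) \<longlonglongrightarrow> \<i> * of_int (k $ j) * fourier_coeff (\<lambda>x. of_real (f x)) k"
    unfolding coeffD by (intro tendsto_intros)
  have 2: "(\<lambda>n. fourier_coeff (\<lambda>x. of_real (D n x)) k) \<longlonglongrightarrow> fourier_coeff (\<lambda>x. of_real (partial_deriv j f x)) k"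
    unfolding fourier_coeff_character
  proof (intro tendsto_divide tendsto_const integral_dominated_convergence[where w = "\<lambda>_. B"])
    show "(\<lambda>x. complex_of_real (partial_deriv j f x) * character (- k) x) \<in> borel_measurable (lebesgue_on torus)"
      by (intro borel_measurable_integrable integrable_torus continuous_intros smooth_torus_continuous g)
    show "(\<lambda>x. complex_of_real (D n x) * character (- k) x) \<in> borel_measurable (lebesgue_on torus)" for n
      by (intro borel_measurable_integrable integrable_torus continuous_intros contD)
    show "integrable (lebesgue_on (torus :: (real ^ 'n) set)) (\<lambda>_. B)"
      by (intro integrable_torus continuous_intros)
    show "AE x in lebesgue_on torus. (\<lambda>n. complex_of_real (D n x) * character (- k) x)
        \<longlonglongrightarrow> complex_of_real (partial_deriv j f x) * character (- k) x"
      by (intro AE_I2 tendsto_intros D_lim)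
    show "AE x in lebesgue_on torus. norm (complex_of_real (D n x) * character (- k) x) \<le> B" for n
      by (intro AE_I2) (simp add: norm_mult D_bound)
  qed simp
  show ?thesis by (rule LIMSEQ_unique[OF 2 1])
qed

text \<open>The symbol of the differential operator \<open>\<Prod>\<^sub>i (1 - \<partial>\<^sub>i\<^sup>2)\<close>. It dominates \<open>1 + |k|\<^sup>2\<close>, and being a product it
  has a reciprocal that is plainly summable.\<close>

definition freq_weight :: "int ^ 'n \<Rightarrow> real" where
  "freq_weight k = (\<Prod>i\<in>UNIV. 1 + (of_int (k $ i))\<^sup>2)"

lemma freq_weight_ge: "freq_weight k \<ge> 1 + (norm (freq k))\<^sup>2"
proof -
  have "(\<Prod>i\<in>A. 1 + (of_int (k $ i))\<^sup>2) \<ge> 1 + (\<Sum>i\<in>A. (real_of_int (k $ i))\<^sup>2)" if "finite A" for A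
    using that
  proof (induction A rule: finite_induct)
    case (insert j A)
    have "1 + ((real_of_int (k $ j))\<^sup>2 + (\<Sum>i\<in>A. (real_of_int (k $ i))\<^sup>2))
        \<le> (1 + (of_int (k $ j))\<^sup>2) * (1 + (\<Sum>i\<in>A. (real_of_int (k $ i))\<^sup>2))"
      by (simp add: algebra_simps sum_nonneg)
    also have "\<dots> \<le> (1 + (of_int (k $ j))\<^sup>2) * (\<Prod>i\<in>A. 1 + (of_int (k $ i))\<^sup>2)"
      by (intro mult_left_mono insert.IH) simp
    finally show ?case using insert by simp
  qed simp
  then show ?thesis by (simp add: freq_weight_def norm_freq_squared)
qed

lemma freq_weight_pos: "freq_weight k > 0"
  using freq_weight_ge[of k] by (smt (verit) zero_le_power2)

text \<open>The function \<open>v\<close> is \<open>\<Prod>\<^sub>i (1 - \<partial>\<^sub>i\<^sup>2) f\<close>, built up one coordinate at a time.\<close>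

lemma fourier_coeff_smooth_multiplier:
  fixes f :: "real ^ 'n \<Rightarrow> real"
  assumes "smooth_torus f"
  obtains v where "smooth_torus v"
    "\<And>k. fourier_coeff (\<lambda>x. of_real (v x)) k = of_real (freq_weight k) * fourier_coeff (\<lambda>x. of_real (f x)) k"
proof -
  have "\<exists>v. smooth_torus v \<and> (\<forall>k. fourier_coeff (\<lambda>x. of_real (v x)) k
      = of_real (\<Prod>i\<in>A. 1 + (of_int (k $ i))\<^sup>2) * fourier_coeff (\<lambda>x. of_real (f x)) k)"
    if "finite A" for A :: "'n set"
    using that
  proof (induction A rule: finite_induct)
    case empty
    then show ?case using assms by auto
  next
    case (insert j A)
    then obtain v where v: "smooth_torus v" "\<And>k. fourier_coeff (\<lambda>x. of_real (v x)) k
      = of_real (\<Prod>i\<in>A. 1 + (of_int (k $ i))\<^sup>2) * fourier_coeff (\<lambda>x. of_real (f x)) k" by blast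
    let ?v1 = "partial_deriv j v" let ?v2 = "partial_deriv j ?v1"
    have s: "smooth_torus ?v1" "smooth_torus ?v2" by (intro smooth_torus_partial_deriv v)+
    have "fourier_coeff (\<lambda>x. of_real (v x - ?v2 x)) k
      = of_real (1 + (of_int (k $ j))\<^sup>2) * fourier_coeff (\<lambda>x. of_real (v x)) k" for k
    proof -
      have "fourier_coeff (\<lambda>x. of_real (v x - ?v2 x)) k
        = fourier_coeff (\<lambda>x. of_real (v x)) k - fourier_coeff (\<lambda>x. of_real (?v2 x)) k"
        unfolding of_real_diff
        by (intro fourier_coeff_diff continuous_intros smooth_torus_continuous v s)
      also have "\<dots> = of_real (1 + (of_int (k $ j))\<^sup>2) * fourier_coeff (\<lambda>x. of_real (v x)) k"
        unfolding fourier_coeff_partial_deriv[OF s(1)] fourier_coeff_partial_deriv[OF v(1)]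
        by (simp add: algebra_simps power2_eq_square)
      finally show ?thesis .
    qed
    then show ?case using insert.hyps v(2) smooth_torus_diff[OF v(1) s(2)]
      by (intro exI[of _ "\<lambda>x. v x - ?v2 x"]) (simp add: mult.assoc)
  qed
  from this[of UNIV] show ?thesis using that by (auto simp: freq_weight_def)
qed

lemma summable_inverse_freq_weight: "(\<lambda>k :: int ^ 'n. 1 / freq_weight k) summable_on UNIV"
proof -
  let ?b = "\<lambda>m :: int. 1 / (1 + (real_of_int m)\<^sup>2)"
  have nat: "summable (\<lambda>n :: nat. 1 / (1 + (real n)\<^sup>2))"
  proof (rule summable_comparison_test_ev[OF _ inverse_power_summable[of 2, where 'a=real]])
    show "\<forall>\<^sub>F n in sequentially. norm (1 / (1 + (real n)\<^sup>2)) \<le> inverse ((of_nat n)\<^sup>2)"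
      using eventually_gt_at_top[of 0] by eventually_elim (simp add: inverse_eq_divide frac_le)
  qed simp
  then have on_nat: "(\<lambda>n :: nat. 1 / (1 + (real n)\<^sup>2)) summable_on UNIV"
    by (intro norm_summable_imp_summable_on) simp
  have "?b summable_on range int" "?b summable_on range (\<lambda>n. - int n)"
    by (subst summable_on_reindex; simp add: inj_on_def o_def on_nat)+
  then have "?b summable_on (range int \<union> range (\<lambda>n. - int n))"
    by (rule summable_on_union)
  moreover have "range int \<union> range (\<lambda>n. - int n) = UNIV"
    by (metis (no_types, lifting) UNIV_eq_I UnI1 UnI2 int_cases2 rangeI)
  ultimately have b: "?b summable_on UNIV" by simp
  define S where "S = infsum ?b UNIV"
  show ?thesis
  proof (rule nonneg_bdd_above_summable_on)
    show "0 \<le> 1 / freq_weight k" for k :: "int ^ 'n" using freq_weight_pos[of k] by simp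
    show "bdd_above (sum (\<lambda>k :: int ^ 'n. 1 / freq_weight k) ` {F. F \<subseteq> UNIV \<and> finite F})"
    proof (rule bdd_aboveI2)
      fix F :: "(int ^ 'n) set" assume "F \<in> {F. F \<subseteq> UNIV \<and> finite F}"
      then have F: "finite F" by simp
      \<comment> \<open>\<open>F\<close> lies in the finite box of all frequencies with coordinates in \<open>C\<close>.\<close>
      define C where "C = (\<Union>i. (\<lambda>k. k $ i) ` F)"
      have C: "finite C" using F by (simp add: C_def)
      have "(\<Sum>k\<in>F. 1 / freq_weight k) = (\<Sum>g\<in>vec_nth ` F. \<Prod>i\<in>UNIV. ?b (g i))"
        by (subst sum.reindex) (auto simp: inj_on_def vec_nth_inject freq_weight_def prod_dividef)
      also have "\<dots> \<le> (\<Sum>g\<in>PiE (UNIV :: 'n set) (\<lambda>_. C). \<Prod>i\<in>UNIV. ?b (g i))"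
      proof (rule sum_mono2)
        show "finite (PiE (UNIV :: 'n set) (\<lambda>_. C))" by (intro finite_PiE) (auto simp: C)
      qed (auto simp: C_def intro!: prod_nonneg)
      also have "\<dots> = (\<Prod>i\<in>(UNIV :: 'n set). \<Sum>m\<in>C. ?b m)"
        by (rule prod_sum_PiE[symmetric]) (auto simp: C)
      also have "\<dots> \<le> (\<Prod>i\<in>(UNIV :: 'n set). S)"
        unfolding S_def
        by (intro prod_mono conjI sum_nonneg finite_sum_le_infsum b C) auto
      finally show "(\<Sum>k\<in>F. 1 / freq_weight k) \<le> (\<Prod>i\<in>(UNIV :: 'n set). S)" .
    qed
  qed
qed

text \<open>Two applications of the operator with symbol \<open>freq_weight\<close> bound the coefficients by a multiple of
  \<open>freq_weight k\<close> to the power \<open>- 2\<close>. One factor absorbs \<open>1 + |k|\<^sup>2\<close> and the other is summable.\<close>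

lemma fourier_coeff_summable:
  fixes f :: "real ^ 'n \<Rightarrow> real"
  assumes "smooth_torus f"
  shows "(\<lambda>k. (1 + (norm (freq k))\<^sup>2) * norm (fourier_coeff (\<lambda>x. of_real (f x)) k)) summable_on UNIV"
proof -
  obtain v where v: "smooth_torus v"
    "\<And>k. fourier_coeff (\<lambda>x. of_real (v x)) k = of_real (freq_weight k) * fourier_coeff (\<lambda>x. of_real (f x)) k"
    using fourier_coeff_smooth_multiplier[OF assms] by metis
  obtain w where w: "smooth_torus w"
    "\<And>k. fourier_coeff (\<lambda>x. of_real (w x)) k = of_real (freq_weight k) * fourier_coeff (\<lambda>x. of_real (v x)) k"
    using fourier_coeff_smooth_multiplier[OF v(1)] by metis
  obtain B where B: "\<And>x. norm (w x) \<le> B" "B \<ge> 0"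
    using periodic_continuous_bounded[OF smooth_torus_periodic[OF w(1)] smooth_torus_continuous[OF w(1)]] by metis
  show ?thesis
  proof (rule summable_on_comparison_test)
    show "(\<lambda>k :: int ^ 'n. B * (1 / freq_weight k)) summable_on UNIV"
      by (intro summable_on_cmult_right summable_inverse_freq_weight)
    fix k :: "int ^ 'n"
    let ?a = "norm (fourier_coeff (\<lambda>x. of_real (f x)) k)"
    have "norm (fourier_coeff (\<lambda>x. of_real (w x)) k) \<le> B"
      by (intro norm_fourier_coeff_le continuous_intros smooth_torus_continuous w) (use B in simp)
    then have "freq_weight k * (freq_weight k * ?a) \<le> B"
      using freq_weight_pos[of k] by (simp add: w(2) v(2) norm_mult)
    then have "freq_weight k * ?a \<le> B / freq_weight k"
      using freq_weight_pos[of k] by (simp add: pos_le_divide_eq mult.commute)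
    then show "(1 + (norm (freq k))\<^sup>2) * ?a \<le> B * (1 / freq_weight k)"
      using mult_right_mono[OF freq_weight_ge[of k], of ?a] by simp
  qed simp
qed

section \<open>Fourier inversion\<close>

text \<open>One finite set \<open>F\<close> truncates, up to \<open>\<epsilon>\<close>, all series dominated by \<open>b\<close> at the same time. With it,
  statements on the exchange of an infinite sum with an integral or a limit reduce to finite sums.\<close>

lemma summable_tail:
  fixes b :: "'a \<Rightarrow> real"
  assumes b: "b summable_on UNIV" and nonneg: "\<And>k. 0 \<le> b k" and "\<epsilon> > 0"
  obtains F where "finite F"
    "\<And>c :: 'a \<Rightarrow> complex. (\<And>k. norm (c k) \<le> b k) \<Longrightarrow> norm (infsum c UNIV - sum c F) \<le> \<epsilon>"
    "infsum b (- F) \<le> \<epsilon>"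
proof -
  have "(sum b \<longlongrightarrow> infsum b UNIV) (finite_subsets_at_top UNIV)"
    using has_sum_infsum[OF b] by (simp add: has_sum_def)
  then have "\<forall>\<^sub>F F in finite_subsets_at_top UNIV. dist (sum b F) (infsum b UNIV) < \<epsilon>"
    using \<open>\<epsilon> > 0\<close> by (rule tendstoD)
  then obtain F where F: "finite F" "dist (sum b F) (infsum b UNIV) < \<epsilon>"
    by (auto simp: eventually_finite_subsets_at_top)
  have bF: "b summable_on - F" "b summable_on F"
    using b by (rule summable_on_subset_banach; simp)+
  have "infsum b UNIV = infsum b F + infsum b (- F)"
    using infsum_Un_disjoint[OF bF(2) bF(1)] by simp
  then have tail: "infsum b (- F) \<le> \<epsilon>"
    using F by (simp add: dist_real_def)
  have "norm (infsum c UNIV - sum c F) \<le> \<epsilon>" if c: "\<And>k. norm (c k) \<le> b k" for c :: "'a \<Rightarrow> complex"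
  proof -
    have abs: "(\<lambda>k. norm (c k)) summable_on A" if "b summable_on A" for A
      by (rule summable_on_comparison_test[OF that]) (auto simp: c)
    have sc: "c summable_on F" "c summable_on - F"
      by (rule abs_summable_summable, rule abs, rule bF)+
    have "infsum c UNIV = infsum c F + infsum c (- F)"
      using infsum_Un_disjoint[OF sc] by simp
    then have "norm (infsum c UNIV - sum c F) = norm (infsum c (- F))"
      using F by simp
    also have "\<dots> \<le> infsum (\<lambda>k. norm (c k)) (- F)"
      by (rule norm_infsum_bound, rule abs, rule bF)
    also have "\<dots> \<le> infsum b (- F)"
      by (rule infsum_mono, rule abs, rule bF, rule bF, rule c)
    finally show ?thesis using tail by simp
  qed
  then show ?thesis using that[OF F(1)] tail by blast
qed

text \<open>The integral of \<open>h * p\<close> vanishes for every trigonometric polynomial \<open>p\<close>, hence by density also for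
  \<open>p = cnj h\<close>: the integral of \<open>|h|\<^sup>2\<close> is zero.\<close>

lemma fourier_series_unique:
  fixes h :: "real ^ 'n \<Rightarrow> complex"
  assumes per: "periodic_2pi h" and cont: "continuous_on UNIV h" and zero: "\<And>k. fourier_coeff h k = 0"
  shows "h x = 0"
proof -
  have orth: "(LINT x|lebesgue_on torus. h x * p x) = 0" if "trig_poly p" for p
    using that
  proof induction
    case (monomial c k)
    have "(LINT x|lebesgue_on torus. h x * character k x) = 0"
      using zero[of "- k"] by (simp add: fourier_coeff_character)
    then show ?case by (simp add: mult.left_commute[of _ c])
  next
    case (add p q)
    have "integrable (lebesgue_on torus) (\<lambda>x. h x * p x)" "integrable (lebesgue_on torus) (\<lambda>x. h x * q x)"
      by (intro integrable_torus continuous_intros cont trig_poly_continuous add.hyps)+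
    then show ?case using add by (simp add: distrib_left)
  qed
  obtain B where B: "B \<ge> 0" "\<And>x. norm (h x) \<le> B"
    using periodic_continuous_bounded[OF per cont] by metis
  let ?V = "(2 * pi) ^ CARD('n)"
  have sq: "h x * cnj (h x) = of_real ((norm (h x))\<^sup>2)" for x
    by (rule complex_norm_square[symmetric])
  let ?I = "LINT x|lebesgue_on torus. h x * cnj (h x)"
  have "norm ?I \<le> \<epsilon>" if "\<epsilon> > 0" for \<epsilon>
  proof -
    define \<delta> where "\<delta> = \<epsilon> / (?V * (B + 1))"
    have \<delta>: "\<delta> > 0"
      unfolding \<delta>_def using that B(1) by (intro divide_pos_pos mult_pos_pos add_nonneg_pos) auto
    have "periodic_2pi (\<lambda>x. cnj (h x))" "continuous_on UNIV (\<lambda>x. cnj (h x))"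
      using per by (auto simp: periodic_2pi_def intro!: continuous_intros cont)
    then obtain p where p: "trig_poly p" "\<And>x. norm (cnj (h x) - p x) < \<delta>"
      using trig_poly_dense[OF _ _ \<delta>] by metis
    note pc = trig_poly_continuous[OF p(1), of UNIV]
    have "?I = (LINT x|lebesgue_on torus. h x * cnj (h x)) - (LINT x|lebesgue_on torus. h x * p x)"
      by (simp add: orth[OF p(1)])
    also have "\<dots> = (LINT x|lebesgue_on torus. h x * (cnj (h x) - p x))"
      unfolding right_diff_distrib
      by (intro Bochner_Integration.integral_diff[symmetric] integrable_torus continuous_intros cont pc)
    also have "norm \<dots> \<le> ?V * (B * \<delta>)"
      by (intro norm_integral_torus_le continuous_intros cont pc)
        (auto simp: norm_mult intro!: mult_mono B less_imp_le[OF p(2)])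
    also have "\<dots> \<le> ?V * ((B + 1) * \<delta>)"
      using \<delta> by (intro mult_left_mono mult_right_mono) auto
    also have "\<dots> = \<epsilon>" using B(1) by (simp add: \<delta>_def)
    finally show ?thesis .
  qed
  then have "norm ?I \<le> 0" using field_le_epsilon[of "norm ?I" 0] by simp
  then have "(LINT x|lebesgue_on torus. (norm (h x))\<^sup>2) = 0"
    unfolding sq integral_complex_of_real norm_of_real by linarith
  moreover have i: "integrable (lebesgue_on torus) (\<lambda>x. (norm (h x))\<^sup>2)"
    by (intro integrable_torus continuous_intros cont)
  ultimately have "((\<lambda>x. (norm (h x))\<^sup>2) has_integral 0) torus"
    using has_integral_integral_lebesgue_on[OF i] by (simp add: torus_def)
  note hi = this[unfolded torus_def]
  have "(norm (h y))\<^sup>2 = 0" if "y \<in> torus" for y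
  proof (rule has_integral_0_cbox_imp_0[OF _ _ hi])
    show "continuous_on (cbox (\<chi> i. - pi) (\<chi> i. pi)) (\<lambda>x. (norm (h x))\<^sup>2)"
      by (intro continuous_intros continuous_on_subset[OF cont]) simp
    show "box (\<chi> i. - pi) (\<chi> i. pi) \<noteq> ({} :: (real ^ 'n) set)"
      by (simp add: interval_eq_empty_cart not_le)
  qed (use that in \<open>simp_all add: torus_def\<close>)
  moreover obtain m where "x + (2 * pi) *\<^sub>R freq m \<in> torus" by (rule translate_into_torus)
  ultimately show ?thesis using periodic_2pi_add_freq[OF per, of x m] by simp
qed

text \<open>The sum \<open>v\<close> of the Fourier series is a continuous periodic function with the same coefficients as
  \<open>f\<close>, so uniqueness applies.\<close>

lemma fourier_inversion:
  fixes f :: "real ^ 'n \<Rightarrow> real"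
  assumes f: "smooth_torus f"
  shows "((\<lambda>k. fourier_coeff (\<lambda>x. of_real (f x)) k * character k x) has_sum of_real (f x)) UNIV"
proof -
  define u where "u = (\<lambda>x. complex_of_real (f x))"
  define a where "a = fourier_coeff u"
  define v where "v = (\<lambda>x. \<Sum>\<^sub>\<infinity>k. a k * character k x)"
  have contu: "continuous_on UNIV u" and peru: "periodic_2pi u"
    using smooth_torus_periodic[OF f] smooth_torus_continuous[OF f]
    by (auto simp: u_def periodic_2pi_def intro!: continuous_intros)
  have abs: "(\<lambda>k. norm (a k)) summable_on UNIV"
    using fourier_coeff_summable[OF f]
    by (rule summable_on_comparison_test) (auto simp: a_def u_def mult_le_cancel_right1 algebra_simps)
  have tail: "\<exists>F. finite F \<and> (\<forall>x. norm (v x - (\<Sum>k\<in>F. a k * character k x)) \<le> \<epsilon>)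
     \<and> (\<forall>l. l \<notin> F \<longrightarrow> norm (a l) \<le> \<epsilon>)" if pos: "\<epsilon> > 0" for \<epsilon>
  proof -
    obtain F where F: "finite F" "\<And>c :: int ^ 'n \<Rightarrow> complex. (\<And>k. norm (c k) \<le> norm (a k)) \<Longrightarrow> norm (infsum c UNIV - sum c F) \<le> \<epsilon>"
      "infsum (\<lambda>k. norm (a k)) (- F) \<le> \<epsilon>"
      using summable_tail[OF abs _ pos] by auto
    have "norm (a l) \<le> \<epsilon>" if "l \<notin> F" for l
    proof -
      have "(\<lambda>k. norm (a k)) summable_on - F" using abs by (rule summable_on_subset_banach) simp
      then have "sum (\<lambda>k. norm (a k)) {l} \<le> infsum (\<lambda>k. norm (a k)) (- F)"
        by (rule finite_sum_le_infsum) (use that in auto)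
      then show ?thesis using F(3) by simp
    qed
    then show ?thesis using F by (auto simp: v_def norm_mult)
  qed
  have contv: "continuous_on UNIV v"
  proof -
    have "\<forall>n. \<exists>F. finite F \<and> (\<forall>x. norm (v x - (\<Sum>k\<in>F. a k * character k x)) \<le> inverse (real (Suc n)))"
      using tail by (metis inverse_positive_iff_positive of_nat_0_less_iff zero_less_Suc)
    then obtain F where F: "\<And>n x. norm (v x - (\<Sum>k\<in>F n. a k * character k x)) \<le> inverse (real (Suc n))"
      by metis
    show ?thesis
    proof (rule uniform_limit_theorem[where F = sequentially])
    show "\<forall>\<^sub>F n in sequentially. continuous_on UNIV (\<lambda>x. \<Sum>k\<in>F n. a k * character k x)"
      by (intro always_eventually allI continuous_intros)
    show "uniform_limit UNIV (\<lambda>n x. \<Sum>k\<in>F n. a k * character k x) v sequentially"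
    proof (rule uniform_limitI)
      fix e :: real assume "e > 0"
      then have "\<forall>\<^sub>F n in sequentially. inverse (real (Suc n)) < e"
        by (rule order_tendstoD(2)[OF LIMSEQ_inverse_real_of_nat])
      then show "\<forall>\<^sub>F n in sequentially. \<forall>x\<in>UNIV. dist (\<Sum>k\<in>F n. a k * character k x) (v x) < e"
        by eventually_elim (use F in \<open>auto simp: dist_norm norm_minus_commute intro: le_less_trans\<close>)
    qed
    qed simp
  qed
  have "character k (x + axis i (2 * pi)) = character k x" for k :: "int ^ 'n" and x i
    using periodic_character[of k] unfolding periodic_2pi_def by blast
  then have perv: "periodic_2pi v"
    by (simp only: v_def periodic_2pi_def simp_thms)
  have coeffv: "fourier_coeff v l = a l" for l
  proof -
    have "norm (fourier_coeff v l - a l) \<le> e" if "e > 0" for e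
    proof -
      have "e / 2 > 0" using that by simp
      from tail[OF this] obtain F where F: "finite F" "\<And>x. norm (v x - (\<Sum>k\<in>F. a k * character k x)) \<le> e / 2"
        "l \<notin> F \<Longrightarrow> norm (a l) \<le> e / 2" by blast
      let ?s = "\<lambda>x. \<Sum>k\<in>F. a k * character k x"
      have "fourier_coeff ?s l = (\<Sum>k\<in>F. a k * (LINT x|lebesgue_on torus. character (k - l) x)) / of_real ((2 * pi) ^ CARD('n))"
        unfolding fourier_coeff_character sum_distrib_right
        by (subst Bochner_Integration.integral_sum)
          (auto simp: mult.assoc character_mult intro!: integrable_torus continuous_intros)
      also have "\<dots> = (\<Sum>k\<in>F. if k = l then a k else 0)"
        unfolding sum_divide_distrib by (rule sum.cong) (auto simp: integral_torus_character)
      finally have s: "fourier_coeff ?s l = (if l \<in> F then a l else 0)" using F(1) by simp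
      have "fourier_coeff v l - fourier_coeff ?s l = fourier_coeff (\<lambda>x. v x - ?s x) l"
        by (intro fourier_coeff_diff[symmetric] continuous_intros contv)
      moreover have "norm (fourier_coeff (\<lambda>x. v x - ?s x) l) \<le> e / 2"
        by (intro norm_fourier_coeff_le continuous_intros contv F(2))
      ultimately have "norm (fourier_coeff v l - fourier_coeff ?s l) \<le> e / 2" by simp
      moreover have "norm (fourier_coeff ?s l - a l) \<le> e / 2" using F(3) that by (auto simp: s)
      moreover have "norm (fourier_coeff v l - a l)
          \<le> norm (fourier_coeff v l - fourier_coeff ?s l) + norm (fourier_coeff ?s l - a l)"
        using norm_triangle_ineq[of "fourier_coeff v l - fourier_coeff ?s l" "fourier_coeff ?s l - a l"] by simp
      ultimately show ?thesis by linarith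
    qed
    then have "norm (fourier_coeff v l - a l) \<le> 0"
      using field_le_epsilon[of "norm (fourier_coeff v l - a l)" 0] by simp
    then show ?thesis by simp
  qed
  have "u x - v x = 0"
  proof (rule fourier_series_unique[of "\<lambda>x. u x - v x"])
    show "periodic_2pi (\<lambda>x. u x - v x)" using peru perv by (simp add: periodic_2pi_def)
    show "continuous_on UNIV (\<lambda>x. u x - v x)" by (intro continuous_intros contu contv)
    show "fourier_coeff (\<lambda>x. u x - v x) k = 0" for k
      by (simp add: fourier_coeff_diff contu contv coeffv) (simp add: a_def)
  qed
  then have "v x = u x" by simp
  moreover have "(\<lambda>k. a k * character k x) summable_on UNIV"
    by (rule abs_summable_summable) (simp add: norm_mult abs)
  ultimately show ?thesis
    unfolding v_def u_def a_def using has_sum_infsum by metis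
qed

section \<open>The heat flow on Fourier series\<close>

lemma integral_std_normal:
  fixes f :: "real \<Rightarrow> 'b::{banach, second_countable_topology}"
  assumes "f \<in> borel_measurable borel"
  shows "integral\<^sup>L std_normal_distribution f = (\<integral>z. std_normal_density z *\<^sub>R f z \<partial>lborel)"
    and "integrable std_normal_distribution f \<longleftrightarrow> integrable lborel (\<lambda>z. std_normal_density z *\<^sub>R f z)"
  using assms by (auto simp: integrable_density intro!: integral_density)

lemma std_normal_abs_moment:
  "integrable std_normal_distribution (\<lambda>z. \<bar>z\<bar>)" "(\<integral>z. \<bar>z\<bar> \<partial>std_normal_distribution) \<le> 1"
proof -
  have m0: "has_bochner_integral lborel std_normal_density 1"
    and m2: "has_bochner_integral lborel (\<lambda>z. std_normal_density z * z\<^sup>2) 1"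
    using std_normal_moment_even[of 0] std_normal_moment_even[of 1] by (simp_all add: fact_numeral)
  show i: "integrable std_normal_distribution (\<lambda>z. \<bar>z\<bar>)"
    using integrable_std_normal_moment_abs[of 1] by (simp add: integral_std_normal)
  have "(\<integral>z. \<bar>z\<bar> \<partial>std_normal_distribution) = (\<integral>z. std_normal_density z * \<bar>z\<bar> \<partial>lborel)"
    by (simp add: integral_std_normal)
  also have "\<dots> \<le> (\<integral>z. (std_normal_density z + std_normal_density z * z\<^sup>2) / 2 \<partial>lborel)"
  proof (rule integral_mono)
    show "integrable lborel (\<lambda>z. std_normal_density z * \<bar>z\<bar>)"
      using integrable_std_normal_moment_abs[of 1] by simp
    show "integrable lborel (\<lambda>z. (std_normal_density z + std_normal_density z * z\<^sup>2) / 2)"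
      using m0 m2 by (auto simp: has_bochner_integral_iff)
    fix z :: real
    have "\<bar>z\<bar> \<le> (1 + z\<^sup>2) / 2"
      using zero_le_power2[of "\<bar>z\<bar> - 1"] by (simp add: power2_eq_square algebra_simps)
    then show "std_normal_density z * \<bar>z\<bar> \<le> (std_normal_density z + std_normal_density z * z\<^sup>2) / 2"
      using mult_left_mono[of "\<bar>z\<bar>" "(1 + z\<^sup>2) / 2" "std_normal_density z"] by (simp add: algebra_simps add_divide_distrib)
  qed
  also have "\<dots> = 1"
    using m0 m2 by (simp add: has_bochner_integral_iff)
  finally show "(\<integral>z. \<bar>z\<bar> \<partial>std_normal_distribution) \<le> 1" .
qed

lemma std_normal_cis: "(\<integral>z. cis (s * z) \<partial>std_normal_distribution) = of_real (exp (- s\<^sup>2 / 2))"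
  using fun_cong[OF char_std_normal_distribution, of s] by (simp add: char_def cis_conv_exp)

lemma measurable_cis_scaled [measurable]: "(\<lambda>z. cis (s * z)) \<in> borel_measurable borel"
  by (intro borel_measurable_continuous_onI continuous_intros)

lemma integrable_std_normal_cis: "integrable std_normal_distribution (\<lambda>z. cis (s * z))"
proof -
  interpret prob_space std_normal_distribution by (rule prob_space_normal_density) simp
  show ?thesis by (rule integrable_const_bound[where B = 1]) auto
qed

lemma integrable_std_normal_ident_cis: "integrable std_normal_distribution (\<lambda>z. of_real z * cis (s * z))"
  by (rule Bochner_Integration.integrable_bound[OF std_normal_abs_moment(1)]) (auto simp: norm_mult)

text \<open>Gaussian integration by parts: the derivative of \<open>z \<mapsto> std_normal_density z * cis (s * z)\<close> integrates
  to zero over the line.\<close>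

lemma std_normal_ident_cis:
  "(\<integral>z. of_real z * cis (s * z) \<partial>std_normal_distribution) = \<i> * of_real (s * exp (- s\<^sup>2 / 2))"
proof -
  define F where "F z = std_normal_density z *\<^sub>R cis (s * z)" for z
  define f where "f z = std_normal_density z *\<^sub>R (\<i> * of_real s * cis (s * z)) - std_normal_density z *\<^sub>R (of_real z * cis (s * z))" for z
  have i1: "integrable lborel (\<lambda>z. std_normal_density z *\<^sub>R (\<i> * of_real s * cis (s * z)))"
    using integrable_mult_right[OF integrable_std_normal_cis[of s], of "\<i> * of_real s"]
    by (simp add: integral_std_normal)
  have i2: "integrable lborel (\<lambda>z. std_normal_density z *\<^sub>R (of_real z * cis (s * z)))"
    using integrable_std_normal_ident_cis[of s] by (simp add: integral_std_normal)
  have lim: "(F \<longlongrightarrow> 0) G" if "filterlim (\<lambda>z::real. z\<^sup>2) at_top G" for G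
  proof -
    have "((\<lambda>z::real. exp (- (z\<^sup>2 / 2))) \<longlongrightarrow> 0) G"
      using filterlim_tendsto_pos_mult_at_top[OF tendsto_const _ that, of "1 / 2"]
      by (intro filterlim_compose[OF exp_at_bot] filterlim_compose[OF filterlim_uminus_at_bot_at_top]) simp
    then have "((\<lambda>z::real. 1 / sqrt (2 * pi) * exp (- z\<^sup>2 / 2)) \<longlongrightarrow> 1 / sqrt (2 * pi) * 0) G"
      by (intro tendsto_intros) simp
    then have "((\<lambda>z. norm (F z)) \<longlongrightarrow> 0) G"
      by (simp add: F_def std_normal_density_def)
    then show ?thesis by (rule tendsto_norm_zero_cancel)
  qed
  have "(LBINT z=-\<infinity>..\<infinity>. f z) = 0 - 0"
  proof (rule interval_integral_FTC_integrable)
    show "(F has_vector_derivative f z) (at z)" for z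
    proof -
      have 1: "(std_normal_density has_real_derivative std_normal_density z * (- z)) (at z)"
      proof -
        have "((\<lambda>z. C * exp (- z\<^sup>2 / 2)) has_real_derivative C * exp (- z\<^sup>2 / 2) * (- z)) (at z)" for C
          by (auto intro!: derivative_eq_intros)
        then show ?thesis unfolding std_normal_density_def[abs_def] .
      qed
      have 2: "((\<lambda>z. cis (s * z)) has_vector_derivative \<i> * of_real s * cis (s * z)) (at z)"
        unfolding cis_conv_exp
        by (auto intro!: derivative_eq_intros has_vector_derivative_real_field)
      show ?thesis
        unfolding F_def f_def
        using has_vector_derivative_scaleR[OF 1 2] by (simp add: scaleR_conv_of_real algebra_simps)
    qed
    have "continuous_on UNIV f"
      unfolding f_def std_normal_density_def[abs_def] by (intro continuous_intros) auto
    then show "isCont f z" for z by (simp add: continuous_on_eq_continuous_at)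
    show "set_integrable lborel (einterval (- \<infinity>) \<infinity>) f"
      using Bochner_Integration.integrable_diff[OF i1 i2] by (simp add: set_integrable_def f_def[abs_def])
    show "((F \<circ> real_of_ereal) \<longlongrightarrow> 0) (at_right (- \<infinity>))"
      unfolding ereal_tendsto_simps
      by (rule lim, rule filterlim_pow_at_bot_even) (simp_all add: filterlim_ident)
    show "((F \<circ> real_of_ereal) \<longlongrightarrow> 0) (at_left \<infinity>)"
      unfolding ereal_tendsto_simps
      by (rule lim, rule filterlim_pow_at_top) (simp_all add: filterlim_ident)
  qed simp
  then have "(\<integral>z. f z \<partial>lborel) = 0"
    by (simp add: interval_lebesgue_integral_def set_lebesgue_integral_def)
  then have "(\<integral>z. std_normal_density z *\<^sub>R (of_real z * cis (s * z)) \<partial>lborel)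
      = (\<integral>z. std_normal_density z *\<^sub>R (\<i> * of_real s * cis (s * z)) \<partial>lborel)"
    unfolding f_def using i1 i2 by simp
  also have "\<dots> = \<i> * of_real s * (\<integral>z. cis (s * z) \<partial>std_normal_distribution)"
    by (simp add: integral_std_normal flip: mult_scaleR_right)
  finally show ?thesis
    by (simp add: integral_std_normal(1)[symmetric] std_normal_cis)
qed

lemma character_translate_axis:
  "character k (x + (r * z) *\<^sub>R axis j 1) = character k x * cis (r * of_int (k $ j) * z)"
  by (simp add: character_add character_axis mult_ac)

text \<open>Averaging a trigonometric sum over Gaussian translations in direction \<open>j\<close> multiplies the
  \<open>k\<close>-th coefficient by \<open>exp (- r\<^sup>2 k\<^sub>j\<^sup>2 / 2)\<close>; inserting the factor \<open>z\<close>, as in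
  \<open>gaussian_average_ident_trig\<close>, moreover applies \<open>r\<close> times the derivative in direction \<open>j\<close>.\<close>

lemma gaussian_average_trig:
  fixes c :: "int ^ 'n \<Rightarrow> complex"
  shows "has_bochner_integral std_normal_distribution (\<lambda>z. \<Sum>k\<in>F. c k * character k (x + (r * z) *\<^sub>R axis j 1))
      (\<Sum>k\<in>F. c k * of_real (exp (- (r * of_int (k $ j))\<^sup>2 / 2)) * character k x)"
  unfolding character_translate_axis
proof (rule has_bochner_integral_sum)
  fix k :: "int ^ 'n"
  have "has_bochner_integral std_normal_distribution (\<lambda>z. c k * character k x * cis (r * of_int (k $ j) * z))
      (c k * character k x * of_real (exp (- (r * of_int (k $ j))\<^sup>2 / 2)))"
    by (intro has_bochner_integral_mult_right)
      (simp add: has_bochner_integral_iff integrable_std_normal_cis std_normal_cis)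
  then show "has_bochner_integral std_normal_distribution (\<lambda>z. c k * (character k x * cis (r * of_int (k $ j) * z)))
      (c k * of_real (exp (- (r * of_int (k $ j))\<^sup>2 / 2)) * character k x)"
    by (simp add: mult_ac)
qed

lemma gaussian_average_ident_trig:
  fixes c :: "int ^ 'n \<Rightarrow> complex"
  shows "has_bochner_integral std_normal_distribution (\<lambda>z. of_real z * (\<Sum>k\<in>F. c k * character k (x + (r * z) *\<^sub>R axis j 1)))
      (of_real r * (\<Sum>k\<in>F. \<i> * of_int (k $ j) * c k * of_real (exp (- (r * of_int (k $ j))\<^sup>2 / 2)) * character k x))"
  unfolding character_translate_axis sum_distrib_left
proof (rule has_bochner_integral_sum)
  fix k :: "int ^ 'n"
  have "has_bochner_integral std_normal_distribution (\<lambda>z. c k * character k x * (of_real z * cis (r * of_int (k $ j) * z)))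
      (c k * character k x * (\<i> * of_real (r * of_int (k $ j) * exp (- (r * of_int (k $ j))\<^sup>2 / 2))))"
    by (intro has_bochner_integral_mult_right)
      (simp only: has_bochner_integral_iff integrable_std_normal_ident_cis std_normal_ident_cis simp_thms)
  then show "has_bochner_integral std_normal_distribution (\<lambda>z. of_real z * (c k * (character k x * cis (r * of_int (k $ j) * z))))
      (of_real r * (\<i> * of_int (k $ j) * c k * of_real (exp (- (r * of_int (k $ j))\<^sup>2 / 2)) * character k x))"
    by (simp add: mult_ac)
qed

text \<open>An average of values at most \<open>M\<close> is at most \<open>M\<close>. The average is only taken of the finite partial
  sums, which are at most \<open>M\<close> up to a small error.\<close>

lemma gaussian_average_le:
  fixes c :: "int ^ 'n \<Rightarrow> complex"
  assumes c: "(\<lambda>k. norm (c k)) summable_on UNIV"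
    and le: "\<And>x. Re (\<Sum>\<^sub>\<infinity>k. c k * character k x) \<le> M"
  shows "Re (\<Sum>\<^sub>\<infinity>k. c k * of_real (exp (- (r * of_int (k $ j))\<^sup>2 / 2)) * character k x) \<le> M"
proof (rule field_le_epsilon)
  fix e :: real assume "e > 0"
  let ?d = "\<lambda>k. c k * of_real (exp (- (r * of_int (k $ j))\<^sup>2 / 2))"
  have pos: "e / 2 > 0" using \<open>e > 0\<close> by simp
  obtain F where F: "\<And>b :: int ^ 'n \<Rightarrow> complex. (\<And>k. norm (b k) \<le> norm (c k)) \<Longrightarrow> norm (infsum b UNIV - sum b F) \<le> e / 2"
    by (rule summable_tail[OF c _ pos]) auto
  have F1: "norm ((\<Sum>\<^sub>\<infinity>k. c k * character k y) - (\<Sum>k\<in>F. c k * character k y)) \<le> e / 2" for y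
    by (rule F) (simp add: norm_mult)
  have F2: "norm ((\<Sum>\<^sub>\<infinity>k. ?d k * character k x) - (\<Sum>k\<in>F. ?d k * character k x)) \<le> e / 2"
    by (rule F) (simp add: norm_mult mult_left_le)
  interpret prob_space std_normal_distribution by (rule prob_space_normal_density) simp
  let ?S = "\<lambda>z. \<Sum>k\<in>F. c k * character k (x + (r * z) *\<^sub>R axis j 1)"
  note G = gaussian_average_trig[where F = F and c = c and x = x and r = r and j = j]
  have i: "integrable std_normal_distribution ?S" and v: "integral\<^sup>L std_normal_distribution ?S = (\<Sum>k\<in>F. ?d k * character k x)"
    using G by (auto simp: has_bochner_integral_iff)
  have "Re (\<Sum>k\<in>F. ?d k * character k x) = (\<integral>z. Re (?S z) \<partial>std_normal_distribution)"
    unfolding v[symmetric] by (rule integral_Re[symmetric, OF i])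
  also have "\<dots> \<le> (\<integral>z. M + e / 2 \<partial>std_normal_distribution)"
  proof (rule integral_mono)
    show "integrable std_normal_distribution (\<lambda>z. Re (?S z))" using i by (rule integrable_Re)
    fix z
    show "Re (?S z) \<le> M + e / 2"
      using abs_Re_le_cmod[of "(\<Sum>\<^sub>\<infinity>k. c k * character k (x + (r * z) *\<^sub>R axis j 1)) - ?S z"]
        F1[of "x + (r * z) *\<^sub>R axis j 1"] le[of "x + (r * z) *\<^sub>R axis j 1"] by simp
  qed simp
  also have "\<dots> = M + e / 2" using prob_space by simp
  finally show "Re (\<Sum>\<^sub>\<infinity>k. ?d k * character k x) \<le> M + e"
    using abs_Re_le_cmod[of "(\<Sum>\<^sub>\<infinity>k. ?d k * character k x) - (\<Sum>k\<in>F. ?d k * character k x)"] F2 by simp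
qed

text \<open>The derivative of a Gaussian average of a function bounded by \<open>N\<close> is bounded by \<open>N / r\<close>, as
  \<open>r\<close> times that derivative is the average of the function against the weight \<open>z\<close> of first absolute
  moment at most 1.\<close>

lemma gaussian_average_derivative_le:
  fixes c :: "int ^ 'n \<Rightarrow> complex"
  assumes c: "(\<lambda>k. (1 + (norm (freq k))\<^sup>2) * norm (c k)) summable_on UNIV"
    and le: "\<And>x. norm (\<Sum>\<^sub>\<infinity>k. c k * character k x) \<le> N" and r: "r > 0"
  shows "norm (\<Sum>\<^sub>\<infinity>k. \<i> * of_int (k $ j) * c k * of_real (exp (- (r * of_int (k $ j))\<^sup>2 / 2)) * character k x) \<le> N / r"
proof -
  let ?d = "\<lambda>k. \<i> * of_int (k $ j) * c k * of_real (exp (- (r * of_int (k $ j))\<^sup>2 / 2))"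
  let ?L = "norm (\<Sum>\<^sub>\<infinity>k. ?d k * character k x)"
  have freq: "\<bar>of_int (k $ j)\<bar> \<le> 1 + (norm (freq k))\<^sup>2" for k :: "int ^ 'n"
  proof -
    have "\<bar>of_int (k $ j)\<bar> \<le> norm (freq k)"
      using component_le_norm_cart[of "freq k" j] by (simp add: freq_def)
    moreover have "2 * norm (freq k) \<le> 1 + (norm (freq k))\<^sup>2"
      using zero_le_power2[of "norm (freq k) - 1"] by (simp add: power2_eq_square algebra_simps)
    ultimately show ?thesis using norm_ge_zero[of "freq k"] by linarith
  qed
  have "r * ?L \<le> N + e" if "e > 0" for e
  proof -
    define \<delta> where "\<delta> = e / (1 + r)"
    have pos: "\<delta> > 0" using that r by (simp add: \<delta>_def)
    obtain F where F: "\<And>b :: int ^ 'n \<Rightarrow> complex. (\<And>k. norm (b k) \<le> (1 + (norm (freq k))\<^sup>2) * norm (c k))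
        \<Longrightarrow> norm (infsum b UNIV - sum b F) \<le> \<delta>"
      by (rule summable_tail[OF c _ pos]) auto
    have F1: "norm ((\<Sum>\<^sub>\<infinity>k. c k * character k y) - (\<Sum>k\<in>F. c k * character k y)) \<le> \<delta>" for y
      by (rule F) (simp add: norm_mult algebra_simps)
    have F2: "norm ((\<Sum>\<^sub>\<infinity>k. ?d k * character k x) - (\<Sum>k\<in>F. ?d k * character k x)) \<le> \<delta>"
    proof (rule F)
      fix k
      have "norm (?d k * character k x) \<le> \<bar>of_int (k $ j)\<bar> * norm (c k)"
        by (simp add: norm_mult mult_left_le)
      also have "\<dots> \<le> (1 + (norm (freq k))\<^sup>2) * norm (c k)"
        by (intro mult_right_mono freq) simp
      finally show "norm (?d k * character k x) \<le> (1 + (norm (freq k))\<^sup>2) * norm (c k)" .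
    qed
    let ?S = "\<lambda>z. \<Sum>k\<in>F. c k * character k (x + (r * z) *\<^sub>R axis j 1)"
    have S: "norm (?S z) \<le> N + \<delta>" for z
      using norm_triangle_ineq3[of "?S z" "\<Sum>\<^sub>\<infinity>k. c k * character k (x + (r * z) *\<^sub>R axis j 1)"]
        F1[of "x + (r * z) *\<^sub>R axis j 1"] le[of "x + (r * z) *\<^sub>R axis j 1"] by (simp add: norm_minus_commute)
    have N: "N + \<delta> \<ge> 0" using S[of 0] norm_ge_zero[of "?S 0"] by linarith
    note G = gaussian_average_ident_trig[where F = F and c = c and x = x and r = r and j = j]
    have "norm (of_real r * (\<Sum>k\<in>F. ?d k * character k x)) = norm (\<integral>z. of_real z * ?S z \<partial>std_normal_distribution)"
      using G by (simp only: has_bochner_integral_iff)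
    also have "\<dots> \<le> (\<integral>z. norm (of_real z * ?S z) \<partial>std_normal_distribution)"
      by (rule integral_norm_bound)
    also have "\<dots> \<le> (\<integral>z. \<bar>z\<bar> * (N + \<delta>) \<partial>std_normal_distribution)"
    proof (rule integral_mono)
      show "integrable std_normal_distribution (\<lambda>z. norm (of_real z * ?S z))"
        using G by (intro integrable_norm) (simp add: has_bochner_integral_iff)
      show "integrable std_normal_distribution (\<lambda>z. \<bar>z\<bar> * (N + \<delta>))"
        using std_normal_abs_moment(1) by simp
    qed (auto simp: norm_mult intro!: mult_left_mono S)
    also have "\<dots> \<le> N + \<delta>"
      using mult_right_mono[OF std_normal_abs_moment(2) N] by simp
    finally have "r * norm (\<Sum>k\<in>F. ?d k * character k x) \<le> N + \<delta>"
      using r by (simp add: norm_mult)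
    moreover have "?L \<le> norm (\<Sum>k\<in>F. ?d k * character k x) + \<delta>"
      using norm_triangle_ineq3[of "\<Sum>\<^sub>\<infinity>k. ?d k * character k x" "\<Sum>k\<in>F. ?d k * character k x"] F2 by linarith
    ultimately have "r * ?L \<le> N + \<delta> + r * \<delta>"
      using mult_left_mono[of ?L "norm (\<Sum>k\<in>F. ?d k * character k x) + \<delta>" r] r by (simp add: distrib_left)
    also have "\<dots> = N + \<delta> * (1 + r)" by (simp add: algebra_simps)
    also have "\<dots> = N + e" using r by (simp add: \<delta>_def)
    finally show ?thesis .
  qed
  then have "r * ?L \<le> N" by (rule field_le_epsilon)
  then show ?thesis using r by (simp add: pos_le_divide_eq mult.commute)
qed

text \<open>The heat flow in the coordinates of \<open>A\<close> is a composition of one-dimensional Gaussian averages of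
  variance \<open>2 * t\<close>, so it preserves upper bounds.\<close>

lemma partial_heat_flow_le:
  fixes c :: "int ^ 'n \<Rightarrow> complex"
  assumes "finite A" "t \<ge> 0" and c: "(\<lambda>k. norm (c k)) summable_on UNIV"
    and le: "\<And>x. Re (\<Sum>\<^sub>\<infinity>k. c k * character k x) \<le> M"
  shows "Re (\<Sum>\<^sub>\<infinity>k. c k * of_real (exp (- t * (\<Sum>i\<in>A. (of_int (k $ i))\<^sup>2))) * character k x) \<le> M"
  using assms(1)
proof (induction A arbitrary: x rule: finite_induct)
  case empty
  then show ?case using le by simp
next
  case (insert j A)
  let ?d = "\<lambda>k. c k * of_real (exp (- t * (\<Sum>i\<in>A. (of_int (k $ i))\<^sup>2)))"
  have "norm (?d k) \<le> norm (c k)" for k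
    using \<open>t \<ge> 0\<close> by (simp add: norm_mult mult_left_le sum_nonneg)
  then have "(\<lambda>k. norm (?d k)) summable_on UNIV"
    by (intro summable_on_comparison_test[OF c]) auto
  from gaussian_average_le[OF this insert.IH, of "sqrt (2 * t)" j x]
  have "Re (\<Sum>\<^sub>\<infinity>k. ?d k * of_real (exp (- (sqrt (2 * t) * of_int (k $ j))\<^sup>2 / 2)) * character k x) \<le> M" .
  also have "(\<lambda>k. ?d k * of_real (exp (- (sqrt (2 * t) * of_int (k $ j))\<^sup>2 / 2)) * character k x)
     = (\<lambda>k. c k * of_real (exp (- t * (\<Sum>i\<in>insert j A. (of_int (k $ i))\<^sup>2))) * character k x)"
  proof
    fix k
    have "exp (- t * (\<Sum>i\<in>insert j A. (real_of_int (k $ i))\<^sup>2))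
       = exp (- t * (\<Sum>i\<in>A. (of_int (k $ i))\<^sup>2)) * exp (- (sqrt (2 * t) * of_int (k $ j))\<^sup>2 / 2)"
      using insert.hyps \<open>t \<ge> 0\<close> by (simp add: power_mult_distrib algebra_simps flip: exp_add)
    then show "?d k * of_real (exp (- (sqrt (2 * t) * of_int (k $ j))\<^sup>2 / 2)) * character k x
      = c k * of_real (exp (- t * (\<Sum>i\<in>insert j A. (of_int (k $ i))\<^sup>2))) * character k x"
      by simp
  qed
  finally show ?case .
qed

text \<open>Maximum principle for the heat flow.\<close>

lemma heat_flow_le:
  fixes c :: "int ^ 'n \<Rightarrow> complex"
  assumes "t \<ge> 0" "(\<lambda>k. norm (c k)) summable_on UNIV"
    "\<And>x. Re (\<Sum>\<^sub>\<infinity>k. c k * character k x) \<le> M"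
  shows "Re (\<Sum>\<^sub>\<infinity>k. c k * of_real (exp (- t * (norm (freq k))\<^sup>2)) * character k x) \<le> M"
  unfolding norm_freq_squared by (rule partial_heat_flow_le) (use assms in auto)

text \<open>The heat flow at time \<open>t\<close> of the \<open>j\<close>-th derivative of a function bounded by \<open>N\<close> is at most
  \<open>N / sqrt (2 * t)\<close>: coordinate \<open>j\<close> gives this bound, and the other coordinates preserve it.\<close>

lemma heat_flow_derivative_le:
  fixes c :: "int ^ 'n \<Rightarrow> complex"
  assumes c: "(\<lambda>k. (1 + (norm (freq k))\<^sup>2) * norm (c k)) summable_on UNIV"
    and c': "(\<lambda>k. norm (\<i> * of_int (k $ j) * c k)) summable_on UNIV"
    and le: "\<And>x. norm (\<Sum>\<^sub>\<infinity>k. c k * character k x) \<le> N" and t: "t > 0"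
  shows "Re (\<Sum>\<^sub>\<infinity>k. \<i> * of_int (k $ j) * c k * of_real (exp (- t * (norm (freq k))\<^sup>2)) * character k x)
     \<le> N / sqrt (2 * t)"
proof -
  let ?d = "\<lambda>k. \<i> * of_int (k $ j) * c k * of_real (exp (- (sqrt (2 * t) * of_int (k $ j))\<^sup>2 / 2))"
  have "(\<lambda>k. norm (?d k)) summable_on UNIV"
    by (rule summable_on_comparison_test[OF c']) (auto simp: norm_mult mult_left_le)
  moreover have "Re (\<Sum>\<^sub>\<infinity>k. ?d k * character k y) \<le> N / sqrt (2 * t)" for y
    by (rule order_trans[OF complex_Re_le_cmod gaussian_average_derivative_le[OF c le]]) (use t in auto)
  ultimately have "Re (\<Sum>\<^sub>\<infinity>k. ?d k * of_real (exp (- t * (\<Sum>i\<in>UNIV - {j}. (of_int (k $ i))\<^sup>2))) * character k x)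
     \<le> N / sqrt (2 * t)"
    using t by (intro partial_heat_flow_le) auto
  also have "(\<lambda>k. ?d k * of_real (exp (- t * (\<Sum>i\<in>UNIV - {j}. (of_int (k $ i))\<^sup>2))) * character k x)
     = (\<lambda>k. \<i> * of_int (k $ j) * c k * of_real (exp (- t * (norm (freq k))\<^sup>2)) * character k x)"
  proof
    fix k
    have "(norm (freq k))\<^sup>2 = (of_int (k $ j))\<^sup>2 + (\<Sum>i\<in>UNIV - {j}. (real_of_int (k $ i))\<^sup>2)"
      unfolding norm_freq_squared by (rule sum.remove) auto
    then have "exp (- t * (norm (freq k))\<^sup>2)
       = exp (- (sqrt (2 * t) * of_int (k $ j))\<^sup>2 / 2) * exp (- t * (\<Sum>i\<in>UNIV - {j}. (of_int (k $ i))\<^sup>2))"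
      using t by (simp add: power_mult_distrib algebra_simps flip: exp_add)
    then show "?d k * of_real (exp (- t * (\<Sum>i\<in>UNIV - {j}. (of_int (k $ i))\<^sup>2))) * character k x
      = \<i> * of_int (k $ j) * c k * of_real (exp (- t * (norm (freq k))\<^sup>2)) * character k x"
      by simp
  qed
  finally show ?thesis .
qed

section \<open>Subordination of fractional powers\<close>

text \<open>The weight \<open>t powr (- 1 - \<beta>)\<close> on the positive half-line, extended by zero to the real line.\<close>

definition frac_kernel :: "real \<Rightarrow> real \<Rightarrow> real" where
  "frac_kernel \<beta> t = indicator {0<..} t * t powr (- 1 - \<beta>)"

lemma frac_kernel_nonneg: "0 \<le> frac_kernel \<beta> t"
  by (simp add: frac_kernel_def)

lemma frac_kernel_measurable [measurable]: "frac_kernel \<beta> \<in> borel_measurable borel"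
  unfolding frac_kernel_def[abs_def] by measurable

lemma has_bochner_integral_nonneg_has_integral:
  fixes f :: "real \<Rightarrow> real"
  assumes "f \<in> borel_measurable borel" "\<And>x. 0 \<le> f x" "(f has_integral I) UNIV"
  shows "has_bochner_integral lborel f I"
proof (rule has_bochner_integral_nn_integral)
  show "integral\<^sup>N lborel f = ennreal I" by (rule nn_integral_has_integral_lborel[OF assms])
  show "0 \<le> I" using has_integral_nonneg[OF assms(3)] assms(2) by simp
qed (use assms in auto)

lemma frac_kernel_tail:
  assumes "\<beta> > 0" "T > 0"
  shows "has_bochner_integral lborel (\<lambda>t. frac_kernel \<beta> t * indicator {T..} t) (T powr - \<beta> / \<beta>)"
proof (rule has_bochner_integral_nonneg_has_integral)
  have "((\<lambda>t. t powr (- 1 - \<beta>)) has_integral T powr - \<beta> / \<beta>) {T..}"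
    using has_integral_powr_to_inf[of "- 1 - \<beta>" T] assms by (simp add: field_simps)
  then show "((\<lambda>t. frac_kernel \<beta> t * indicator {T..} t) has_integral T powr - \<beta> / \<beta>) UNIV"
    using assms by (subst (asm) has_integral_restrict_UNIV[symmetric])
      (auto elim!: has_integral_eq[rotated] simp: frac_kernel_def indicator_def)
qed (auto simp: frac_kernel_nonneg)

lemma frac_kernel_min_integrable:
  assumes "0 < \<beta>" "\<beta> < 1"
  shows "integrable lborel (\<lambda>t. frac_kernel \<beta> t * min 1 t)"
proof (rule Bochner_Integration.integrable_bound)
  let ?g = "\<lambda>t. indicator {0..1} t * t powr (- \<beta>)"
  have "((\<lambda>t. t powr (- \<beta>)) has_integral 1 powr (- \<beta> + 1) / (- \<beta> + 1)) {0..1}"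
    by (rule has_integral_powr_from_0) (use assms in auto)
  then have "(?g has_integral 1 powr (- \<beta> + 1) / (- \<beta> + 1)) UNIV"
    by (subst (asm) has_integral_restrict_UNIV[symmetric])
      (auto elim!: has_integral_eq[rotated] simp: indicator_def)
  then have "has_bochner_integral lborel ?g (1 powr (- \<beta> + 1) / (- \<beta> + 1))"
    by (intro has_bochner_integral_nonneg_has_integral) auto
  then show "integrable lborel (\<lambda>t. ?g t + frac_kernel \<beta> t * indicator {1..} t)"
    using frac_kernel_tail[OF assms(1), of 1] by (auto simp: has_bochner_integral_iff)
  have "frac_kernel \<beta> t * min 1 t \<le> ?g t + frac_kernel \<beta> t * indicator {1..} t" for t
  proof (cases "0 < t \<and> t < 1")
    case True
    then have "t powr (- 1 - \<beta>) * t = t powr (- \<beta>)"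
      using powr_add[of t "- 1 - \<beta>" 1] by simp
    then show ?thesis using True by (simp add: frac_kernel_def)
  qed (auto simp: frac_kernel_def indicator_def)
  moreover have "0 \<le> frac_kernel \<beta> t * min 1 t" for t
    by (auto simp: frac_kernel_def indicator_def)
  ultimately show "AE t in lborel. norm (frac_kernel \<beta> t * min 1 t) \<le> norm (?g t + frac_kernel \<beta> t * indicator {1..} t)"
    by (intro AE_I2) (smt (verit) real_norm_def)
qed measurable

lemma one_minus_exp_le_min:
  fixes s t :: real
  assumes "0 \<le> s" "0 \<le> t"
  shows "1 - exp (- t * s) \<le> (1 + s) * min 1 t" "0 \<le> 1 - exp (- t * s)"
proof -
  have "1 - exp (- t * s) \<le> t * s" using exp_ge_add_one_self[of "- t * s"] by simp
  also have "t * s \<le> (1 + s) * t" using assms by (simp add: algebra_simps)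
  finally have "1 - exp (- t * s) \<le> (1 + s) * t" .
  moreover have "1 - exp (- t * s) \<le> 1 + s" using assms exp_gt_zero[of "- t * s"] by linarith
  ultimately show "1 - exp (- t * s) \<le> (1 + s) * min 1 t" by (simp add: min_def)
  show "0 \<le> 1 - exp (- t * s)" using assms by simp
qed

lemma frac_kernel_exp_integrable:
  assumes "0 < \<beta>" "\<beta> < 1" "0 \<le> s"
  shows "integrable lborel (\<lambda>t. frac_kernel \<beta> t * (1 - exp (- t * s)))"
proof (rule Bochner_Integration.integrable_bound)
  show "integrable lborel (\<lambda>t. (1 + s) * (frac_kernel \<beta> t * min 1 t))"
    by (intro integrable_mult_right frac_kernel_min_integrable assms)
  have "norm (frac_kernel \<beta> t * (1 - exp (- t * s))) \<le> norm ((1 + s) * (frac_kernel \<beta> t * min 1 t))" for t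
  proof (cases "t > 0")
    case True
    have "frac_kernel \<beta> t * (1 - exp (- t * s)) \<le> frac_kernel \<beta> t * ((1 + s) * min 1 t)"
      by (intro mult_left_mono one_minus_exp_le_min frac_kernel_nonneg) (use True assms in auto)
    moreover have "0 \<le> frac_kernel \<beta> t * (1 - exp (- t * s))"
      by (intro mult_nonneg_nonneg one_minus_exp_le_min frac_kernel_nonneg) (use True assms in auto)
    ultimately show ?thesis by (simp add: mult.left_commute)
  qed (simp add: frac_kernel_def)
  then show "AE t in lborel. norm (frac_kernel \<beta> t * (1 - exp (- t * s))) \<le> norm ((1 + s) * (frac_kernel \<beta> t * min 1 t))"
    by simp
qed measurable

text \<open>The normalising constant of the subordination formula
  \<open>frac_const \<beta> * s powr \<beta> = \<integral> (1 - exp (- t * s)) * t powr (- 1 - \<beta>) dt\<close> over \<open>t > 0\<close>, read off at \<open>s = 1\<close>.\<close>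

definition frac_const :: "real \<Rightarrow> real" where
  "frac_const \<beta> = (\<integral>t. frac_kernel \<beta> t * (1 - exp (- t)) \<partial>lborel)"

lemma frac_kernel_subordination:
  assumes "0 < \<beta>" "\<beta> < 1" "0 \<le> s"
  shows "has_bochner_integral lborel (\<lambda>t. frac_kernel \<beta> t * (1 - exp (- t * s))) (frac_const \<beta> * s powr \<beta>)"
proof (cases "s = 0")
  case False
  then have s: "s > 0" using assms by simp
  \<comment> \<open>Substitute \<open>s * t\<close> for \<open>t\<close>.\<close>
  have "frac_const \<beta> = \<bar>s\<bar> *\<^sub>R (\<integral>t. frac_kernel \<beta> (0 + s * t) * (1 - exp (- (0 + s * t))) \<partial>lborel)"
    unfolding frac_const_def by (rule lborel_integral_real_affine) (use s in simp)
  also have "(\<lambda>t. frac_kernel \<beta> (0 + s * t) * (1 - exp (- (0 + s * t))))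
      = (\<lambda>t. s powr (- 1 - \<beta>) * (frac_kernel \<beta> t * (1 - exp (- t * s))))"
    using s by (auto simp: frac_kernel_def indicator_def powr_mult zero_less_mult_iff mult_ac)
  also have "\<bar>s\<bar> *\<^sub>R (\<integral>t. s powr (- 1 - \<beta>) * (frac_kernel \<beta> t * (1 - exp (- t * s))) \<partial>lborel)
      = s powr (- \<beta>) * (\<integral>t. frac_kernel \<beta> t * (1 - exp (- t * s)) \<partial>lborel)"
    using s powr_add[of s 1 "- 1 - \<beta>"] by simp
  finally have "frac_const \<beta> * s powr \<beta> = (\<integral>t. frac_kernel \<beta> t * (1 - exp (- t * s)) \<partial>lborel)"
    using s by (simp add: powr_minus field_simps)
  then show ?thesis
    using frac_kernel_exp_integrable[OF assms] by (simp add: has_bochner_integral_iff)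
qed (simp add: has_bochner_integral_zero)

lemma frac_const_pos:
  assumes "0 < \<beta>" "\<beta> < 1"
  shows "frac_const \<beta> > 0"
proof -
  have "0 < (1 - exp (- 1)) * (1 powr - \<beta> / \<beta>)" using assms by simp
  also have "(1 - exp (- 1)) * (1 powr - \<beta> / \<beta>) = (\<integral>t. (1 - exp (- 1)) * (frac_kernel \<beta> t * indicator {1..} t) \<partial>lborel)"
    using frac_kernel_tail[OF assms(1), of 1] by (simp add: has_bochner_integral_iff)
  also have "\<dots> \<le> frac_const \<beta>"
    unfolding frac_const_def
  proof (rule integral_mono)
    show "integrable lborel (\<lambda>t. (1 - exp (- 1)) * (frac_kernel \<beta> t * indicator {1..} t))"
      using frac_kernel_tail[OF assms(1), of 1] by (simp add: has_bochner_integral_iff)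
    show "integrable lborel (\<lambda>t. frac_kernel \<beta> t * (1 - exp (- t)))"
      using frac_kernel_exp_integrable[OF assms, of 1] by simp
    fix t :: real
    show "(1 - exp (- 1)) * (frac_kernel \<beta> t * indicator {1..} t) \<le> frac_kernel \<beta> t * (1 - exp (- t))"
    proof (cases "t \<ge> 1")
      case True
      then have "frac_kernel \<beta> t * (1 - exp (- 1)) \<le> frac_kernel \<beta> t * (1 - exp (- t))"
        by (intro mult_left_mono frac_kernel_nonneg) simp
      then show ?thesis using True by (simp add: mult.commute)
    next
      case False
      then show ?thesis by (simp add: frac_kernel_def indicator_def)
    qed
  qed
  finally show ?thesis .
qed

section \<open>The lower bound at a maximum\<close>

text \<open>For continuous functions the essential supremum bounds every value: the excess of \<open>|f|\<close> over it is
  continuous, non-negative and almost everywhere zero. The essential supremum is finite and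
  non-negative, so \<open>real_of_ereal\<close> does not collapse it.\<close>

lemma continuous_le_Linf_norm:
  fixes f :: "real ^ 'n \<Rightarrow> real"
  assumes per: "periodic_2pi f" and cont: "continuous_on UNIV f"
  shows "\<bar>f x\<bar> \<le> Linf_norm f"
proof -
  let ?M = "lebesgue_on (torus :: (real ^ 'n) set)"
  let ?e = "esssup ?M (\<lambda>x. ereal \<bar>f x\<bar>)"
  obtain B where B: "\<And>x. \<bar>f x\<bar> \<le> B"
    using periodic_continuous_bounded[OF per cont] by auto
  have meas: "(\<lambda>x. ereal \<bar>f x\<bar>) \<in> borel_measurable ?M"
    by (intro borel_measurable_ereal borel_measurable_integrable integrable_torus continuous_intros cont)
  have "?e \<le> ereal B" by (rule esssup_I[OF meas]) (simp add: B)
  moreover have "0 \<le> ?e"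
  proof -
    have "emeasure ?M (space ?M) \<noteq> 0"
      using measure_torus[where 'n = 'n] by (auto simp: measure_def)
    then have "esssup ?M (\<lambda>x. 0 :: ereal) = 0" by (rule esssup_const)
    moreover have "esssup ?M (\<lambda>x. 0 :: ereal) \<le> ?e" by (rule esssup_mono) auto
    ultimately show ?thesis by simp
  qed
  ultimately have e: "?e = ereal (Linf_norm f)"
    unfolding Linf_norm_def by (cases ?e) auto
  have ae: "AE x in ?M. \<bar>f x\<bar> \<le> Linf_norm f"
    using esssup_AE[of "\<lambda>x. ereal \<bar>f x\<bar>" ?M] unfolding e by simp
  define h where "h x = max 0 (\<bar>f x\<bar> - Linf_norm f)" for x
  have conth: "continuous_on S h" for S
    unfolding h_def by (intro continuous_intros continuous_on_subset[OF cont]) simp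
  have i: "integrable ?M h" by (intro integrable_torus conth)
  have "integral\<^sup>L ?M h = 0"
    using ae by (intro integral_eq_zero_AE) (auto simp: h_def elim: eventually_mono)
  then have hi: "(h has_integral 0) (cbox (\<chi> i. - pi) (\<chi> i. pi))"
    using has_integral_integral_lebesgue_on[OF i] by (simp add: torus_def)
  have "h y = 0" if "y \<in> torus" for y
  proof (rule has_integral_0_cbox_imp_0[OF _ _ hi])
    show "box (\<chi> i. - pi) (\<chi> i. pi) \<noteq> ({} :: (real ^ 'n) set)"
      by (simp add: interval_eq_empty_cart not_le)
    show "0 \<le> h z" for z by (simp add: h_def)
  qed (use that conth in \<open>simp_all add: torus_def\<close>)
  moreover obtain m where "x + (2 * pi) *\<^sub>R freq m \<in> torus" by (rule translate_into_torus)
  ultimately have "h (x + (2 * pi) *\<^sub>R freq m) = 0" by blast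
  then show ?thesis using periodic_2pi_add_freq[OF per, of x m] by (simp add: h_def)
qed

lemma norm_powr_eq: "(norm v)\<^sup>2 powr (\<alpha> / 2) = norm v powr \<alpha>"
proof (cases "norm v = 0")
  case False
  then have "(norm v)\<^sup>2 powr (\<alpha> / 2) = (norm v powr 2) powr (\<alpha> / 2)" by (simp add: powr_numeral)
  also have "\<dots> = norm v powr (2 * (\<alpha> / 2))" by (rule powr_powr)
  finally show ?thesis by simp
qed simp

text \<open>With \<open>P t\<close> the heat flow of \<open>g = partial_deriv j f\<close> at \<open>xbar\<close> and time \<open>t\<close>, the subordination formula makes
  \<open>frac_const (\<alpha> / 2)\<close> times the fractional Laplacian the integral of \<open>M - P t\<close> against the
  kernel. The integrand is non-negative, and at least \<open>M / 2\<close> from \<open>T = (2 * N / M)\<^sup>2\<close> on. To avoid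
  exchanging the series with the integral, the formula is applied to a finite set \<open>F\<close> of frequencies,
  with an error of size \<open>min 1 t\<close>, against which the kernel is integrable.\<close>

lemma frac_laplacian_maximum_lower_bound:
  fixes f :: "real ^ 'n \<Rightarrow> real"
  assumes \<alpha>: "0 < \<alpha>" "\<alpha> < 2" and f: "smooth_torus f"
    and N: "\<And>x. \<bar>f x\<bar> \<le> N" "N > 0" and M: "\<And>x. partial_deriv j f x \<le> M" "partial_deriv j f xbar = M" "M > 0"
  shows "M / 2 * ((2 * N / M)\<^sup>2 powr (- (\<alpha> / 2)) / (\<alpha> / 2))
    \<le> frac_const (\<alpha> / 2) * Re (frac_laplacian \<alpha> (\<lambda>x. of_real (partial_deriv j f x)) xbar)"
proof -
  define \<beta> where "\<beta> = \<alpha> / 2"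
  have \<beta>: "0 < \<beta>" "\<beta> < 1" using \<alpha> by (auto simp: \<beta>_def)
  define T where "T = (2 * N / M)\<^sup>2"
  have T: "T > 0" using N(2) M(3) by (simp add: T_def)
  define A where "A = frac_const \<beta>"
  have A: "A > 0" unfolding A_def using \<beta> by (rule frac_const_pos)
  define B where "B = (\<integral>t. frac_kernel \<beta> t * min 1 t \<partial>lborel)"
  have B: "B \<ge> 0" unfolding B_def
    by (intro integral_nonneg_AE AE_I2) (simp add: frac_kernel_def indicator_def)
  define g where "g = partial_deriv j f"
  have g: "smooth_torus g" unfolding g_def by (rule smooth_torus_partial_deriv[OF f])
  define c where "c = fourier_coeff (\<lambda>x. of_real (f x))"
  define a where "a = fourier_coeff (\<lambda>x. of_real (g x))"
  define b where "b k = (1 + (norm (freq k))\<^sup>2) * norm (a k)" for k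
  have ac: "a k = \<i> * of_int (k $ j) * c k" for k
    unfolding a_def c_def g_def by (rule fourier_coeff_partial_deriv[OF f])
  have invf: "(\<Sum>\<^sub>\<infinity>k. c k * character k x) = of_real (f x)" for x
    unfolding c_def using fourier_inversion[OF f] by (rule infsumI)
  have invg: "((\<lambda>k. a k * character k x) has_sum of_real (g x)) UNIV" for x
    unfolding a_def by (rule fourier_inversion[OF g])
  have sumb: "b summable_on UNIV"
    unfolding b_def a_def by (rule fourier_coeff_summable[OF g])
  have a_le_b: "norm (a k) \<le> b k" for k by (simp add: b_def algebra_simps)
  have suma: "(\<lambda>k. norm (a k)) summable_on UNIV"
    by (rule summable_on_comparison_test[OF sumb]) (auto simp: a_le_b)
  define E where "E t k = exp (- t * (norm (freq k))\<^sup>2)" for t and k :: "int ^ 'n"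
  define P where "P t = (\<Sum>\<^sub>\<infinity>k. a k * of_real (E t k) * character k xbar)" for t
  have sumE: "(\<lambda>k. a k * of_real (E t k) * character k xbar) summable_on UNIV" if "t > 0" for t
    by (rule abs_summable_summable, rule summable_on_comparison_test[OF suma])
      (use that in \<open>auto simp: norm_mult E_def mult_left_le\<close>)
  have diff: "((\<lambda>k. of_real (1 - E t k) * (a k * character k xbar)) has_sum (of_real M - P t)) UNIV" if "t > 0" for t
  proof -
    have "((\<lambda>k. a k * character k xbar + - (a k * of_real (E t k) * character k xbar)) has_sum (of_real M + - P t)) UNIV"
      unfolding P_def M(2)[symmetric] g_def[symmetric]
      by (intro has_sum_add invg) (simp only: has_sum_uminus has_sum_infsum[OF sumE[OF that]] minus_minus)
    then show ?thesis by (simp add: algebra_simps)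
  qed
  have P1: "Re (P t) \<le> M" if "t > 0" for t
    unfolding P_def E_def
    by (rule heat_flow_le) (use that suma M(1) infsumI[OF invg] in \<open>auto simp: g_def\<close>)
  have P2: "Re (P t) \<le> M / 2" if "t \<ge> T" for t
  proof -
    have "t > 0" using T that by simp
    have "Re (P t) \<le> N / sqrt (2 * t)"
      unfolding P_def E_def ac
    proof (rule heat_flow_derivative_le)
      show "(\<lambda>k. (1 + (norm (freq k))\<^sup>2) * norm (c k)) summable_on UNIV"
        unfolding c_def by (rule fourier_coeff_summable[OF f])
      show "(\<lambda>k. norm (\<i> * of_int (k $ j) * c k)) summable_on UNIV"
        using suma by (simp only: ac)
      show "norm (\<Sum>\<^sub>\<infinity>k. c k * character k x) \<le> N" for x
        using N(1)[of x] by (simp add: invf)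
    qed fact
    also have "\<dots> \<le> N / (2 * N / M)"
    proof (rule divide_left_mono)
      have "(2 * N / M)\<^sup>2 \<le> 2 * t" using that \<open>t > 0\<close> by (simp add: T_def)
      then show "2 * N / M \<le> sqrt (2 * t)" by (rule real_le_rsqrt)
    qed (use N M \<open>t > 0\<close> in auto)
    also have "\<dots> = M / 2" using N(2) M(3) by simp
    finally show ?thesis .
  qed
  let ?L = "Re (frac_laplacian \<alpha> (\<lambda>x. of_real (g x)) xbar)"
  have "M / 2 * (T powr - \<beta> / \<beta>) \<le> A * ?L + e" if "e > 0" for e
  proof -
    \<comment> \<open>The truncation error enters with weight \<open>B\<close> through the integral and \<open>A\<close> through the series.\<close>
    define \<epsilon> where "\<epsilon> = e / (A + B)"
    have \<epsilon>: "\<epsilon> > 0" using that A B by (simp add: \<epsilon>_def)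
    obtain F where F: "\<And>u :: int ^ 'n \<Rightarrow> complex. (\<And>k. norm (u k) \<le> b k) \<Longrightarrow> norm (infsum u UNIV - sum u F) \<le> \<epsilon>"
      by (rule summable_tail[OF sumb _ \<epsilon>]) (auto simp: b_def)
    define S where "S t = (\<Sum>k\<in>F. (1 - E t k) * Re (a k * character k xbar))" for t
    have S: "M / 2 * indicator {T..} t - \<epsilon> * min 1 t \<le> S t" if t: "t > 0" for t
    proof -
      define m where "m = min 1 t"
      have m: "m > 0" using t by (simp add: m_def)
      \<comment> \<open>After division by \<open>min 1 t\<close> the terms are dominated by \<open>b\<close> uniformly in \<open>t\<close>.\<close>
      define u where "u k = of_real ((1 - E t k) / m) * (a k * character k xbar)" for k
      have "norm (u k) \<le> b k" for k
      proof -
        have "0 \<le> 1 - E t k" "1 - E t k \<le> (1 + (norm (freq k))\<^sup>2) * m"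
          unfolding E_def m_def by (intro one_minus_exp_le_min; use t in simp)+
        then have "\<bar>(1 - E t k) / m\<bar> \<le> 1 + (norm (freq k))\<^sup>2"
          using m by (simp add: pos_divide_le_eq)
        from mult_right_mono[OF this, of "norm (a k)"] show ?thesis
          unfolding u_def b_def norm_mult norm_of_real by simp
      qed
      from F[of u, OF this] have "m * norm (infsum u UNIV - sum u F) \<le> \<epsilon> * m"
        using m by (simp add: mult.commute)
      moreover have "of_real m * infsum u UNIV = of_real M - P t"
      proof -
        have "((\<lambda>k. of_real (1 / m) * (of_real (1 - E t k) * (a k * character k xbar))) has_sum of_real (1 / m) * (of_real M - P t)) UNIV"
          by (rule has_sum_cmult_right[OF diff[OF t]])
        moreover have "of_real (1 / m) * (of_real (1 - E t k) * (a k * character k xbar)) = u k" for k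
          by (simp add: u_def)
        ultimately have "infsum u UNIV = of_real (1 / m) * (of_real M - P t)"
          by (simp only: infsumI)
        then show ?thesis using m by simp
      qed
      moreover have "Re (of_real m * sum u F) = S t"
        using m by (simp add: u_def S_def sum_distrib_left Re_sum)
      moreover have "Re (of_real m * infsum u UNIV - of_real m * sum u F) \<le> m * norm (infsum u UNIV - sum u F)"
      proof -
        have "Re (of_real m * infsum u UNIV - of_real m * sum u F) \<le> norm (of_real m * (infsum u UNIV - sum u F))"
          unfolding right_diff_distrib by (rule complex_Re_le_cmod)
        then show ?thesis using m by (simp add: norm_mult)
      qed
      ultimately have "M - Re (P t) - S t \<le> \<epsilon> * m" by simp
      moreover have "M / 2 * indicator {T..} t \<le> M - Re (P t)"
        using P1[OF t] P2[of t] by (auto simp: indicator_def)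
      ultimately show ?thesis by (simp add: m_def)
    qed
    have tail: "has_bochner_integral lborel (\<lambda>t. M / 2 * (frac_kernel \<beta> t * indicator {T..} t) - \<epsilon> * (frac_kernel \<beta> t * min 1 t))
        (M / 2 * (T powr - \<beta> / \<beta>) - \<epsilon> * B)"
      unfolding B_def
      by (intro has_bochner_integral_diff has_bochner_integral_mult_right frac_kernel_tail
          has_bochner_integral_integrable frac_kernel_min_integrable \<beta> T)
    have "has_bochner_integral lborel (\<lambda>t. \<Sum>k\<in>F. Re (a k * character k xbar) * (frac_kernel \<beta> t * (1 - exp (- t * (norm (freq k))\<^sup>2))))
        (\<Sum>k\<in>F. Re (a k * character k xbar) * (A * (norm (freq k))\<^sup>2 powr \<beta>))"
      unfolding A_def
      by (intro has_bochner_integral_sum has_bochner_integral_mult_right frac_kernel_subordination \<beta>) simp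
    moreover have "(\<lambda>t. \<Sum>k\<in>F. Re (a k * character k xbar) * (frac_kernel \<beta> t * (1 - exp (- t * (norm (freq k))\<^sup>2))))
       = (\<lambda>t. frac_kernel \<beta> t * S t)"
      unfolding S_def E_def sum_distrib_left by (intro ext sum.cong refl) (simp only: mult_ac)
    ultimately have main: "has_bochner_integral lborel (\<lambda>t. frac_kernel \<beta> t * S t)
        (\<Sum>k\<in>F. Re (a k * character k xbar) * (A * (norm (freq k))\<^sup>2 powr \<beta>))" by simp
    have "M / 2 * (T powr - \<beta> / \<beta>) - \<epsilon> * B
        = (\<integral>t. M / 2 * (frac_kernel \<beta> t * indicator {T..} t) - \<epsilon> * (frac_kernel \<beta> t * min 1 t) \<partial>lborel)"
      using tail by (simp only: has_bochner_integral_iff)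
    also have "\<dots> \<le> (\<integral>t. frac_kernel \<beta> t * S t \<partial>lborel)"
    proof (rule integral_mono)
      show "M / 2 * (frac_kernel \<beta> t * indicator {T..} t) - \<epsilon> * (frac_kernel \<beta> t * min 1 t) \<le> frac_kernel \<beta> t * S t" for t
      proof (cases "t > 0")
        case True
        show ?thesis using mult_left_mono[OF S[OF True] frac_kernel_nonneg[of \<beta> t]] by (simp add: algebra_simps)
      qed (simp add: frac_kernel_def)
    qed (use tail main in \<open>simp_all only: has_bochner_integral_iff\<close>)
    also have "\<dots> = (\<Sum>k\<in>F. Re (a k * character k xbar) * (A * (norm (freq k))\<^sup>2 powr \<beta>))"
      using main by (simp only: has_bochner_integral_iff)
    also have "\<dots> = A * Re (\<Sum>k\<in>F. of_real (norm (freq k) powr \<alpha>) * a k * character k xbar)"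
      unfolding Re_sum sum_distrib_left by (rule sum.cong) (simp_all add: \<beta>_def norm_powr_eq algebra_simps)
    finally have 1: "M / 2 * (T powr - \<beta> / \<beta>) - \<epsilon> * B \<le> A * Re (\<Sum>k\<in>F. of_real (norm (freq k) powr \<alpha>) * a k * character k xbar)" .
    have "norm ((\<Sum>\<^sub>\<infinity>k. of_real (norm (freq k) powr \<alpha>) * a k * character k xbar)
        - (\<Sum>k\<in>F. of_real (norm (freq k) powr \<alpha>) * a k * character k xbar)) \<le> \<epsilon>"
    proof (rule F)
      fix k :: "int ^ 'n"
      have "norm (freq k) powr \<alpha> \<le> 1 + (norm (freq k))\<^sup>2"
      proof (cases "norm (freq k) \<le> 1")
        case True
        then have "norm (freq k) powr \<alpha> \<le> 1" using \<alpha> by (simp add: powr_le1)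
        then show ?thesis by (smt (verit) zero_le_power2)
      next
        case False
        then have "norm (freq k) powr \<alpha> \<le> norm (freq k) powr 2" using \<alpha> by (intro powr_mono) auto
        then show ?thesis using False by simp
      qed
      from mult_right_mono[OF this, of "norm (a k)"]
      show "norm (of_real (norm (freq k) powr \<alpha>) * a k * character k xbar) \<le> b k"
        by (simp add: norm_mult b_def)
    qed
    then have "Re (\<Sum>k\<in>F. of_real (norm (freq k) powr \<alpha>) * a k * character k xbar) \<le> ?L + \<epsilon>"
      using abs_Re_le_cmod[of "(\<Sum>\<^sub>\<infinity>k. of_real (norm (freq k) powr \<alpha>) * a k * character k xbar)
        - (\<Sum>k\<in>F. of_real (norm (freq k) powr \<alpha>) * a k * character k xbar)"]
      unfolding frac_laplacian_def a_def[symmetric] character_def[symmetric] by simp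
    from mult_left_mono[OF this, of A] 1 A
    have "M / 2 * (T powr - \<beta> / \<beta>) \<le> A * ?L + \<epsilon> * (A + B)" by (simp add: algebra_simps)
    also have "\<epsilon> * (A + B) = e" using A B by (simp add: \<epsilon>_def)
    finally show ?thesis .
  qed
  then have "M / 2 * (T powr - \<beta> / \<beta>) \<le> A * ?L" by (rule field_le_epsilon)
  then show ?thesis by (simp add: T_def \<beta>_def A_def g_def)
qed

theorem theorem2p3:
  fixes \<alpha> :: real
  assumes "0 < \<alpha>" and "\<alpha> < 2"
  shows "\<exists>c>0. \<forall>(f :: real ^ 'n \<Rightarrow> real) k g xbar.
    smooth_torus f \<and> g = partial_deriv k f \<and>
    xbar \<in> torus \<and> (\<forall>x\<in>torus. g x \<le> g xbar) \<longrightarrow>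
      g xbar \<le> c * Linf_norm f \<or>
      Re (frac_laplacian \<alpha> (\<lambda>x. complex_of_real (g x)) xbar)
        \<ge> g xbar powr (1 + \<alpha>) / (c * Linf_norm f powr \<alpha>)"
proof -
  define A where "A = frac_const (\<alpha> / 2)"
  have A: "A > 0" unfolding A_def by (rule frac_const_pos) (use assms in auto)
  \<comment> \<open>\<open>frac_const\<close> divided by the factors \<open>1 / 2\<close>, \<open>2 / \<alpha>\<close> and \<open>2 powr (- \<alpha>)\<close> of the lower bound.\<close>
  define c where "c = A * \<alpha> * 2 powr \<alpha>"
  have c: "c > 0" using A assms by (simp add: c_def)
  have main: "g xbar \<le> c * Linf_norm f \<or>
      Re (frac_laplacian \<alpha> (\<lambda>x. complex_of_real (g x)) xbar) \<ge> g xbar powr (1 + \<alpha>) / (c * Linf_norm f powr \<alpha>)"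
    if f: "smooth_torus f" and g: "g = partial_deriv k f" and max: "\<forall>x\<in>torus. g x \<le> g xbar"
    for f :: "real ^ 'n \<Rightarrow> real" and k g xbar
  proof -
    define N where "N = Linf_norm f"
    define M where "M = g xbar"
    define L where "L = Re (frac_laplacian \<alpha> (\<lambda>x. complex_of_real (g x)) xbar)"
    have N: "\<bar>f x\<bar> \<le> N" for x
      unfolding N_def by (rule continuous_le_Linf_norm[OF smooth_torus_periodic[OF f] smooth_torus_continuous[OF f]])
    have N0: "N \<ge> 0" using N[of 0] by linarith
    have M: "g x \<le> M" for x
    proof -
      obtain m where "x + (2 * pi) *\<^sub>R freq m \<in> torus" by (rule translate_into_torus)
      then have "g (x + (2 * pi) *\<^sub>R freq m) \<le> M" using max unfolding M_def by blast
      moreover have "periodic_2pi g" unfolding g by (intro smooth_torus_periodic smooth_torus_partial_deriv f)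
      ultimately show ?thesis using periodic_2pi_add_freq by metis
    qed
    consider "M \<le> 0" | "N = 0" | "M > 0" "N > 0" using N0 by linarith
    then have "M \<le> c * N \<or> M powr (1 + \<alpha>) / (c * N powr \<alpha>) \<le> L"
    proof cases
      case 1
      then show ?thesis using c N0 by (smt (verit) mult_nonneg_nonneg)
    next
      case 2
      then have "f = (\<lambda>x. 0)" using N by auto
      then have "M = 0" by (simp add: M_def g partial_deriv_def)
      then show ?thesis using 2 by simp
    next
      case 3
      have "M / 2 * ((2 * N / M)\<^sup>2 powr (- (\<alpha> / 2)) / (\<alpha> / 2)) \<le> A * L"
        unfolding A_def L_def g
        by (rule frac_laplacian_maximum_lower_bound[OF assms f N])
          (use 3 M in \<open>auto simp: M_def g\<close>)
      also have "(2 * N / M)\<^sup>2 powr (- (\<alpha> / 2)) = (2 * N / M) powr (- \<alpha>)"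
        using norm_powr_eq[of "2 * N / M" "- \<alpha>"] 3 by simp
      also have "\<dots> = M powr \<alpha> / (2 powr \<alpha> * N powr \<alpha>)"
        using 3 by (simp add: powr_minus powr_divide powr_mult)
      also have "M / 2 * (M powr \<alpha> / (2 powr \<alpha> * N powr \<alpha>) / (\<alpha> / 2)) = A * (M powr (1 + \<alpha>) / (c * N powr \<alpha>))"
        using 3 A assms by (simp add: c_def powr_add)
      finally have "M powr (1 + \<alpha>) / (c * N powr \<alpha>) \<le> L"
        by (simp only: mult_le_cancel_left_pos[OF A])
      then show ?thesis ..
    qed
    then show ?thesis by (simp add: M_def N_def L_def)
  qed
  show ?thesis
    by (rule exI[of _ c]) (use c main in blast)
qed

end
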